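(* Let $X$ be an abstract state space, let $A,B$ be linear operators on $X$ satisfying Kato's conditions, and let $(V(t))_{t\ge 0}$, with generator $G$, be the associated perturbed (Kato) semigroup. (i) If $(V(t))_{t\ge0}$ is honest, then $(V(t))_{t\ge0}$ is the unique substochastic $C_0$-semigroup whose generator is an extension of $A+B$. (ii) If $(V(t))_{t\ge0}$ is dishonest, then there are infinitely many substochastic $C_0$-semigroups whose generators are extensions of $A+B$.
   Context: An abstract state space is a real ordered Banach space $X$ with closed generating positive cone $X_+$ on which the norm is additive: $\|u+v\|=\|u\|+\|v\|$ for $u,v\in X_+$. $\Psi\in X^*$ is the linear functional with $\langle\Psi,u\rangle=\|u\|$ for $u\in X_+$. $D(A)_+=D(A)\cap X_+$, $R(\lambda,A)=(\lambda-A)^{-1}$. An operator $T$ is substochastic if it is positive and $\|Tu\|\le\|u\|$ for $u\in X_+$; a semigroup is substochastic if each of its operators is. Kato's conditions on $A,B$ with $D(A)\subseteq D(B)\subseteq X$: (1) $A$ generates a substochastic $C_0$-semigroup; (2) $Bu\ge0$ for $u\in D(A)_+$; (3) $\langle\Psi,(A+B)u\rangle\le0$ for all $u\in D(A)_+$. Here $A+B$ has domain $D(A)$. Kato's Theorem (known): under these conditions there is an extension $G$ of $A+B$ generating a substochastic $C_0$-semigroup $(V(t))_{t\ge0}$ (the perturbed, or Kato, semigroup), with $R(\lambda,G)u=\sum_{k\ge0}R(\lambda,A)(BR(\lambda,A))^ku$ for $\lambda>0$, $u\in X$; it is the minimal substochastic $C_0$-semigroup whose generator extends $A+B$. Honesty: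 put $a(u)=-\langle\Psi,Au+Bu\rangle$ for $u\in D(A)$ and define $\bar a:D(G)\to\mathbb R$ by $\bar a(R(\lambda,G)u)=\sum_{k\ge0}a\big(R(\lambda,A)(BR(\lambda,A))^ku\big)$, $u\in X$ (well defined and independent of $\lambda>0$). $(V(t))_{t\ge0}$ is honest if $\|V(t)u\|-\|u\|=-\bar a\big(\int_0^tV(s)u\,ds\big)$ for all $t\ge0$, $u\in X_+$; otherwise it is dishonest. *)

theory Defs
  imports "HOL-Analysis.Analysis" "HOL-Library.FuncSet"
begin

class abstract_state_space = banach + ordered_real_vector +
  assumes closed_nonneg_cone: "closed {u. 0 \<le> u}"
    and generating_nonneg_cone: "\<exists>u v. 0 \<le> u \<and> 0 \<le> v \<and> x = u - v"
    and norm_add_nonneg: "0 \<le> u \<Longrightarrow> 0 \<le> v \<Longrightarrow> norm (u + v) = norm u + norm v"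

definition Psi :: "'a::abstract_state_space \<Rightarrow>\<^sub>L real" where
  "Psi = (THE f. \<forall>u\<ge>0. blinfun_apply f u = norm u)"


text \<open>An unbounded operator is given by its domain \<open>D\<close> and a total function of which only the
  restriction to \<open>D\<close> matters.\<close>

definition linear_operator :: "'a::real_vector set \<Rightarrow> ('a \<Rightarrow> 'a) \<Rightarrow> bool" where
  "linear_operator D A \<longleftrightarrow> subspace D \<and>
     (\<forall>x\<in>D. \<forall>y\<in>D. A (x + y) = A x + A y) \<and> (\<forall>c. \<forall>x\<in>D. A (c *\<^sub>R x) = c *\<^sub>R A x)"

definition operator_extension ::
    "'a set \<Rightarrow> ('a \<Rightarrow> 'a) \<Rightarrow> 'a set \<Rightarrow> ('a \<Rightarrow> 'a) \<Rightarrow> bool" where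
  "operator_extension D' A' D A \<longleftrightarrow> D \<subseteq> D' \<and> (\<forall>x\<in>D. A' x = A x)"

definition resolvent :: "'a::real_vector set \<Rightarrow> ('a \<Rightarrow> 'a) \<Rightarrow> real \<Rightarrow> 'a \<Rightarrow> 'a" where
  "resolvent D A \<mu> = inv_into D (\<lambda>x. \<mu> *\<^sub>R x - A x)"


text \<open>A semigroup is a family indexed by \<open>[0,\<infinity>)\<close>. The extensionality condition fixes the
  irrelevant values at negative times, so that equality of semigroups, and hence the number of
  semigroups with a given property, has its intended meaning.\<close>

definition C0_semigroup :: "(real \<Rightarrow> 'a::banach \<Rightarrow>\<^sub>L 'a) \<Rightarrow> bool" where
  "C0_semigroup T \<longleftrightarrow> T \<in> extensional {0..} \<and>
     T 0 = id_blinfun \<and>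
     (\<forall>s\<ge>0. \<forall>t\<ge>0. T (s + t) = T s o\<^sub>L T t) \<and>
     (\<forall>x. ((\<lambda>t. blinfun_apply (T t) x) \<longlongrightarrow> x) (at_right 0))"

definition generator_domain :: "(real \<Rightarrow> 'a::banach \<Rightarrow>\<^sub>L 'a) \<Rightarrow> 'a set" where
  "generator_domain T =
     {x. \<exists>y. ((\<lambda>h. (blinfun_apply (T h) x - x) /\<^sub>R h) \<longlongrightarrow> y) (at_right 0)}"

definition generator :: "(real \<Rightarrow> 'a::banach \<Rightarrow>\<^sub>L 'a) \<Rightarrow> 'a \<Rightarrow> 'a" where
  "generator T x = Lim (at_right 0) (\<lambda>h. (blinfun_apply (T h) x - x) /\<^sub>R h)"

definition generates ::
    "'a::banach set \<Rightarrow> ('a \<Rightarrow> 'a) \<Rightarrow> (real \<Rightarrow> 'a \<Rightarrow>\<^sub>L 'a) \<Rightarrow> bool" where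
  "generates D A T \<longleftrightarrow>
     C0_semigroup T \<and> generator_domain T = D \<and> (\<forall>x\<in>D. generator T x = A x)"

definition substochastic :: "('a::abstract_state_space \<Rightarrow>\<^sub>L 'a) \<Rightarrow> bool" where
  "substochastic T \<longleftrightarrow>
     (\<forall>u\<ge>0. 0 \<le> blinfun_apply T u) \<and> (\<forall>u\<ge>0. norm (blinfun_apply T u) \<le> norm u)"

definition substochastic_semigroup ::
    "(real \<Rightarrow> 'a::abstract_state_space \<Rightarrow>\<^sub>L 'a) \<Rightarrow> bool" where
  "substochastic_semigroup T \<longleftrightarrow> C0_semigroup T \<and> (\<forall>t\<ge>0. substochastic (T t))"


definition kato_conditions ::
    "'a::abstract_state_space set \<Rightarrow> ('a \<Rightarrow> 'a) \<Rightarrow> 'a set \<Rightarrow> ('a \<Rightarrow> 'a) \<Rightarrow> bool" where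
  "kato_conditions DA A DB B \<longleftrightarrow>
     linear_operator DA A \<and> linear_operator DB B \<and> DA \<subseteq> DB \<and>
     (\<exists>S. substochastic_semigroup S \<and> generates DA A S) \<and>
     (\<forall>u\<in>DA. 0 \<le> u \<longrightarrow> 0 \<le> B u) \<and>
     (\<forall>u\<in>DA. 0 \<le> u \<longrightarrow> blinfun_apply Psi (A u + B u) \<le> 0)"

text \<open>Substochastic semigroups whose generator extends \<open>A + B\<close> (with domain \<open>D(A)\<close>).\<close>

definition extending_semigroups ::
    "'a::abstract_state_space set \<Rightarrow> ('a \<Rightarrow> 'a) \<Rightarrow> ('a \<Rightarrow> 'a) \<Rightarrow> (real \<Rightarrow> 'a \<Rightarrow>\<^sub>L 'a) set" where
  "extending_semigroups DA A B =
     {T. substochastic_semigroup T \<and>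
         operator_extension (generator_domain T) (generator T) DA (\<lambda>u. A u + B u)}"

definition kato_term ::
    "'a::real_vector set \<Rightarrow> ('a \<Rightarrow> 'a) \<Rightarrow> ('a \<Rightarrow> 'a) \<Rightarrow> real \<Rightarrow> 'a \<Rightarrow> nat \<Rightarrow> 'a" where
  "kato_term DA A B \<mu> u k =
     resolvent DA A \<mu> (((\<lambda>v. B (resolvent DA A \<mu> v)) ^^ k) u)"

text \<open>The semigroup provided by Kato's theorem; the resolvent series determines it uniquely.\<close>

definition kato_semigroup ::
    "'a::abstract_state_space set \<Rightarrow> ('a \<Rightarrow> 'a) \<Rightarrow> ('a \<Rightarrow> 'a) \<Rightarrow> (real \<Rightarrow> 'a \<Rightarrow>\<^sub>L 'a) \<Rightarrow> bool" where
  "kato_semigroup DA A B V \<longleftrightarrow>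
     V \<in> extending_semigroups DA A B \<and>
     (\<forall>\<mu>>0. \<forall>u. kato_term DA A B \<mu> u sums resolvent (generator_domain V) (generator V) \<mu> u)"

definition a_fun :: "('a::abstract_state_space \<Rightarrow> 'a) \<Rightarrow> ('a \<Rightarrow> 'a) \<Rightarrow> 'a \<Rightarrow> real" where
  "a_fun A B u = - blinfun_apply Psi (A u + B u)"

text \<open>Meaningful for \<open>x\<close> in the domain of the generator of the Kato semigroup \<open>V\<close>; there the
  value exists and does not depend on \<open>\<mu>\<close>.\<close>

definition a_bar ::
    "'a::abstract_state_space set \<Rightarrow> ('a \<Rightarrow> 'a) \<Rightarrow> ('a \<Rightarrow> 'a) \<Rightarrow> (real \<Rightarrow> 'a \<Rightarrow>\<^sub>L 'a) \<Rightarrow> 'a \<Rightarrow> real" where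
  "a_bar DA A B V x =
     (THE r. \<forall>\<mu>>0. \<forall>u. x = resolvent (generator_domain V) (generator V) \<mu> u \<longrightarrow>
        (\<lambda>k. a_fun A B (kato_term DA A B \<mu> u k)) sums r)"

definition honest ::
    "'a::abstract_state_space set \<Rightarrow> ('a \<Rightarrow> 'a) \<Rightarrow> ('a \<Rightarrow> 'a) \<Rightarrow> (real \<Rightarrow> 'a \<Rightarrow>\<^sub>L 'a) \<Rightarrow> bool" where
  "honest DA A B V \<longleftrightarrow>
     (\<forall>t\<ge>0. \<forall>u\<ge>0. norm (blinfun_apply (V t) u) - norm u =
        - a_bar DA A B V (integral {0..t} (\<lambda>s. blinfun_apply (V s) u)))"

end

theory Submission
  imports Defs
begin

text \<open>Write \<open>R\<^sub>\<lambda> = R(\<lambda>, A)\<close> and let \<open>\<beta>\<^sub>\<lambda> u\<close> be the limit of \<open>\<langle>\<Psi>, (B R\<^sub>\<lambda>)\<^sup>k u\<rangle>\<close> as \<open>k\<close> grows. Telescoping the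
  resolvent series gives \<open>a-bar(x) = - \<langle>\<Psi>, G x\<rangle> - \<Delta> x\<close> with \<open>\<Delta> x = \<beta>\<^sub>\<lambda> ((\<lambda> - G) x)\<close>, a
  graph-norm continuous functional that does not depend on \<open>\<lambda>\<close> and vanishes on \<open>D(A)\<close>; honesty
  means \<open>\<Delta> = 0\<close>. If \<open>\<Delta> = 0\<close>, then \<open>(B R\<^sub>\<lambda>)\<^sup>k u\<close> tends to \<open>0\<close> for \<open>u \<ge> 0\<close>, and the partial sums of the
  series determine the resolvent of every generator extending \<open>A + B\<close>. If \<open>\<Delta> \<noteq> 0\<close>, then the rank-one
  perturbations \<open>G + \<Delta>(\<cdot>) c f\<close> with \<open>f \<ge> 0\<close>, \<open>\<parallel>f\<parallel> = 1\<close>, \<open>0 \<le> c < 1\<close> all extend \<open>A + B\<close> and generate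
  pairwise different substochastic semigroups by a Hille-Yosida argument.\<close>

section \<open>Abstract state spaces\<close>

text \<open>Substochasticity bounds an operator on the cone only; off the cone a bounded
  decomposition into positive parts costs a constant K. Powers and exponentials are therefore
  estimated on the cone first, so that K enters once and uniformly. The functional \<Delta> is
  continuous for the graph norm of \<open>G\<close>. If nonzero, it cannot be continuous for the
  norm of X, because it vanishes on the dense set D(A). So \<open>G + \<Delta>(.) c f\<close> is not
  a bounded perturbation of \<open>G\<close>; but having rank one, its resolvent equation reduces to
  a scalar equation and is solved explicitly. The divisor there is
  \<open>1 - c \<beta>\<^sub>\<lambda> f\<close>, and
  \<open>\<beta>\<^sub>\<lambda> f \<le> norm f\<close> keeps it positive as long as c < 1.
  Independence of \<lambda> is the delicate point of the definition of \<Delta>: the functionals for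
  different \<lambda> are limits along powers of different operators. They are compared by two
  inequalities, through elements of D(A), where \<Delta> vanishes. The honesty equation tests
  \<Delta> only on integrals of orbits. Integral means approximate every element of D(G) in the
  graph norm, which is why nothing is lost.\<close>

lemma nonneg_tendsto:
  fixes f :: "'b \<Rightarrow> 'a::abstract_state_space"
  assumes "(f \<longlongrightarrow> x) F" "F \<noteq> bot" "eventually (\<lambda>t. 0 \<le> f t) F"
  shows "0 \<le> x"
  using Lim_in_closed_set[OF closed_nonneg_cone, of f F x] assms by simp

lemma nonneg_suminf:
  fixes f :: "nat \<Rightarrow> 'a::abstract_state_space"
  assumes "f sums x" "\<And>n. 0 \<le> f n"
  shows "0 \<le> x"
  using nonneg_tendsto[OF assms(1)[unfolded sums_def]] assms(2) by (simp add: sum_nonneg)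

text \<open>Riemann sums of a function with values in the cone lie in the cone, and the cone is
  closed.\<close>

lemma has_integral_nonneg_cone:
  fixes f :: "real \<Rightarrow> 'a::abstract_state_space"
  assumes "(f has_integral y) {a..b}" "\<And>x. x \<in> {a..b} \<Longrightarrow> 0 \<le> f x"
  shows "0 \<le> y"
proof -
  have "y \<in> closure {u. 0 \<le> u}"
  proof (unfold closure_approachable, intro allI impI)
    fix e :: real assume "e > 0"
    with assms(1) obtain \<gamma> where \<gamma>: "gauge \<gamma>"
      "\<And>\<D>. \<D> tagged_division_of {a..b} \<Longrightarrow> \<gamma> fine \<D> \<Longrightarrow>
         norm (sum (\<lambda>(x,k). measure lborel k *\<^sub>R f x) \<D> - y) < e"
      unfolding has_integral_real by metis
    obtain p where p: "p tagged_division_of {a..b}" "\<gamma> fine p"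
      using fine_division_exists_real[OF \<gamma>(1)] by blast
    have "0 \<le> (\<Sum>(x,k)\<in>p. measure lborel k *\<^sub>R f x)"
      using tag_in_interval[OF p(1)] assms(2)
      by (intro sum_nonneg) (auto intro!: scaleR_nonneg_nonneg)
    then show "\<exists>u\<in>{u. 0 \<le> u}. dist u y < e"
      using \<gamma>(2)[OF p] by (auto simp: dist_norm)
  qed
  then show ?thesis
    unfolding closure_closed[OF closed_nonneg_cone] by simp
qed

text \<open>Additivity of the norm on the cone makes \<open>norm u - norm v\<close> depend only on
  \<open>u - v\<close>, so it defines a linear functional on the whole space.\<close>

lemma Psi_ex1: "\<exists>!f::'a::abstract_state_space \<Rightarrow>\<^sub>L real. \<forall>u\<ge>0. blinfun_apply f u = norm u"
proof -
  have "\<exists>p q. \<forall>x::'a. 0 \<le> p x \<and> 0 \<le> q x \<and> x = p x - q x"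
    using generating_nonneg_cone by metis
  then obtain p q where pq: "\<And>x::'a. 0 \<le> p x" "\<And>x::'a. 0 \<le> q x" "\<And>x::'a. x = p x - q x"
    by blast
  define f where "f = (\<lambda>x::'a. norm (p x) - norm (q x))"
  \<comment> \<open>Two decompositions of one vector differ by an exchange of positive summands;
    taking norms of both sides of \<open>p + v = u + q\<close> compares them.\<close>
  have f: "f (u - v) = norm u - norm v" if "0 \<le> u" "0 \<le> v" for u v
  proof -
    have "p (u - v) + v = u + q (u - v)" using pq(3)[of "u - v"] by (simp add: algebra_simps)
    then have "norm (p (u - v)) + norm v = norm u + norm (q (u - v))"
      using that pq by (metis norm_add_nonneg)
    then show ?thesis by (simp add: f_def)
  qed
  have add: "f (x + y) = f x + f y" for x y
  proof -
    have "x + y = (p x + p y) - (q x + q y)"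
      using pq(3)[of x] pq(3)[of y] by (simp add: algebra_simps)
    then have "f (x + y) = norm (p x + p y) - norm (q x + q y)"
      using f pq by (metis add_nonneg_nonneg)
    then show ?thesis using pq by (simp add: norm_add_nonneg f_def)
  qed
  have scale: "f (c *\<^sub>R x) = c * f x" for c x
  proof (cases "0 \<le> c")
    case True
    have "c *\<^sub>R x = c *\<^sub>R p x - c *\<^sub>R q x"
      using arg_cong[OF pq(3)[of x], of "(*\<^sub>R) c"] by (simp add: scaleR_diff_right)
    then have "f (c *\<^sub>R x) = norm (c *\<^sub>R p x) - norm (c *\<^sub>R q x)"
      using f pq True by (metis scaleR_nonneg_nonneg)
    then show ?thesis using True by (simp add: f_def right_diff_distrib)
  next
    case False
    have "c *\<^sub>R x = (-c) *\<^sub>R q x - (-c) *\<^sub>R p x"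
      using arg_cong[OF pq(3)[of x], of "(*\<^sub>R) c"] by (simp add: scaleR_diff_right)
    then have "f (c *\<^sub>R x) = norm ((-c) *\<^sub>R q x) - norm ((-c) *\<^sub>R p x)"
      using f pq False by (metis scaleR_nonneg_nonneg less_eq_real_def neg_0_le_iff_le not_le)
    then show ?thesis using False by (simp add: f_def right_diff_distrib)
  qed
  have "bounded_linear f"
  proof (rule bounded_linear_intro[where K = 1])
    show "f (x + y) = f x + f y" "f (c *\<^sub>R x) = c *\<^sub>R f x" for x y c
      by (simp_all add: add scale)
    \<comment> \<open>The reverse triangle inequality for the two positive parts bounds the
      functional by 1, with no control on the size of the parts.\<close>
    show "norm (f x) \<le> norm x * 1" for x
      using norm_triangle_ineq3[of "p x" "q x"] pq(3)[of x] by (simp add: f_def)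
  qed
  then have "\<forall>u\<ge>0. blinfun_apply (Blinfun f) u = norm u"
    using f[of _ 0] by (simp add: bounded_linear_Blinfun_apply)
  moreover have "g = h" if gh: "\<forall>u\<ge>0. blinfun_apply g u = norm u"
    "\<forall>u\<ge>0. blinfun_apply h u = norm u" for g h :: "'a \<Rightarrow>\<^sub>L real"
  proof (rule blinfun_eqI)
    fix x
    show "blinfun_apply g x = blinfun_apply h x"
      using gh pq by (metis blinfun.diff_right)
  qed
  ultimately show ?thesis by blast
qed

lemma Psi_nonneg: "0 \<le> u \<Longrightarrow> blinfun_apply Psi u = norm u"
  unfolding Psi_def using theI'[OF Psi_ex1] by blast

text \<open>As in the open mapping theorem: by Baire the closure of some set of differences \<open>u - v\<close> with
  bounded \<open>u, v \<ge> 0\<close> contains a ball, and a geometric iteration removes the closure.\<close>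

lemma ex_bounded_decomposition:
  "\<exists>M>0. \<forall>x::'a::abstract_state_space. \<exists>u v.
     0 \<le> u \<and> 0 \<le> v \<and> x = u - v \<and> norm u + norm v \<le> M * norm x"
proof -
  define K :: "real \<Rightarrow> 'a set" where
    "K r = {u - v |u v. 0 \<le> u \<and> 0 \<le> v \<and> norm u + norm v \<le> r}" for r
  have K_iff: "w \<in> K r \<longleftrightarrow> (\<exists>u v. 0 \<le> u \<and> 0 \<le> v \<and> norm u + norm v \<le> r \<and> w = u - v)" for w r
    unfolding K_def by auto
  have K_scale: "c *\<^sub>R w \<in> K (c * r)" if w: "w \<in> K r" and "0 \<le> c" for w c r
  proof -
    obtain u v where uv: "0 \<le> u" "0 \<le> v" "norm u + norm v \<le> r" "w = u - v"
      using w unfolding K_iff by metis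
    have "norm (c *\<^sub>R u) + norm (c *\<^sub>R v) \<le> c * r"
      using uv(3) that(2) by (simp add: mult_left_mono flip: distrib_left)
    then show ?thesis
      unfolding K_iff using uv that(2)
      by (intro exI[of _ "c *\<^sub>R u"] exI[of _ "c *\<^sub>R v"]) (auto simp: scaleR_diff_right scaleR_nonneg_nonneg)
  qed
  have K_diff: "x - y \<in> K (r + s)" if xy: "x \<in> K r" "y \<in> K s" for x y r s
  proof -
    obtain u v u' v' where uv: "0 \<le> u" "0 \<le> v" "norm u + norm v \<le> r" "x = u - v"
      "0 \<le> u'" "0 \<le> v'" "norm u' + norm v' \<le> s" "y = u' - v'"
      using xy unfolding K_iff by metis
    then show ?thesis
      unfolding K_iff
      by (intro exI[of _ "u + v'"] exI[of _ "v + u'"]) (auto simp: norm_add_nonneg)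
  qed
  have cover: "(\<Union>n::nat. closure (K n)) = UNIV"
  proof -
    have "\<exists>n::nat. x \<in> closure (K n)" for x
    proof -
      obtain u v where uv: "0 \<le> u" "0 \<le> v" "x = u - v"
        using generating_nonneg_cone by blast
      obtain n :: nat where "norm u + norm v \<le> n" using real_arch_simple by blast
      then have "x \<in> K n" unfolding K_def using uv by auto
      then show ?thesis using closure_subset by blast
    qed
    then show ?thesis by auto
  qed
  have "\<exists>n::nat. interior (closure (K n)) \<noteq> {}"
  proof (rule ccontr)
    assume "\<not> ?thesis"
    then have "Met_TC.mtopology interior_of \<Union>(range (\<lambda>n::nat. closure (K n))) = {}"
      by (intro Met_TC.metric_Baire_category_alt) (auto simp: complete_UNIV)
    then show False unfolding cover by simp
  qed
  then obtain n :: nat and a where "a \<in> interior (closure (K n))" by blast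
  then obtain e where e: "e > 0" "ball a e \<subseteq> closure (K n)"
    using mem_interior by blast
  \<comment> \<open>Below, \<open>x\<close> is scaled by \<open>c = e / (2 * norm x)\<close> so that
    \<open>a + c x\<close> falls into the ball. A difference of two elements of \<open>K n\<close>
    lies in \<open>K (2 n)\<close>, and dividing by \<open>c\<close> gives
    \<open>4 n / e * norm x\<close>.\<close>
  define C where "C = 4 * n / e"
  have approx: "\<exists>u v. 0 \<le> u \<and> 0 \<le> v \<and> norm u + norm v \<le> C * norm x \<and>
      norm (x - (u - v)) \<le> norm x / 2" for x :: 'a
  proof (cases "x = 0")
    case True then show ?thesis by (intro exI[of _ 0]) auto
  next
    case False
    define c where "c = e / (2 * norm x)"
    have c: "c > 0" using e False by (simp add: c_def)
    have "a + c *\<^sub>R x \<in> ball a e" "a \<in> ball a e"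
      using e False by (auto simp: c_def dist_norm)
    then have "a + c *\<^sub>R x \<in> closure (K n)" "a \<in> closure (K n)" using e by auto
    \<comment> \<open>Two approximation errors of this size add up to \<open>c * norm x / 2\<close>,
      which after division by \<open>c\<close> is the factor 1/2 of the iteration.\<close>
    moreover have "c * norm x / 4 > 0" using c False by simp
    ultimately obtain y z where yz: "y \<in> K n" "dist y (a + c *\<^sub>R x) < c * norm x / 4"
      "z \<in> K n" "dist z a < c * norm x / 4"
      unfolding closure_approachable by blast
    define w where "w = (1/c) *\<^sub>R (y - z)"
    have "w \<in> K ((1/c) * (n + n))"
      unfolding w_def using K_scale[OF K_diff[OF yz(1,3)], of "1/c"] c by simp
    moreover have "(1/c) * (n + n) = C * norm x" by (simp add: c_def C_def)
    moreover have "norm (x - w) \<le> norm x / 2"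
    proof -
      have "c *\<^sub>R (x - w) = (z - a) - (y - (a + c *\<^sub>R x))"
        using c by (simp add: w_def algebra_simps)
      then have "c * norm (x - w) = norm ((z - a) - (y - (a + c *\<^sub>R x)))"
        using c by (metis abs_of_pos norm_scaleR)
      also have "\<dots> \<le> c * norm x / 4 + c * norm x / 4"
        using yz(2,4) norm_triangle_ineq4[of "z - a" "y - (a + c *\<^sub>R x)"]
        by (simp add: dist_norm)
      finally have "c * norm (x - w) \<le> c * (norm x / 2)" by simp
      then show ?thesis using c by (rule mult_left_le_imp_le)
    qed
    ultimately show ?thesis unfolding K_iff by metis
  qed
  then obtain p q where p: "\<And>x::'a. 0 \<le> p x" and q: "\<And>x::'a. 0 \<le> q x"
    and pqn: "\<And>x::'a. norm (p x) + norm (q x) \<le> C * norm x"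
    and pqd: "\<And>x::'a. norm (x - (p x - q x)) \<le> norm x / 2"
    by metis
  have C: "C \<ge> 0" using e by (simp add: C_def)
  have "\<exists>u v. 0 \<le> u \<and> 0 \<le> v \<and> x = u - v \<and> norm u + norm v \<le> (2 * C + 1) * norm x" for x :: 'a
  proof -
    \<comment> \<open>\<open>r k\<close> is what remains of \<open>x\<close> after \<open>k\<close>
      corrections. It halves at each step, so both series of positive parts converge
      absolutely.\<close>
    define r where "r k = ((\<lambda>x. x - (p x - q x)) ^^ k) x" for k
    have r_Suc: "r (Suc k) = r k - (p (r k) - q (r k))" for k by (simp add: r_def)
    have r_norm: "norm (r k) \<le> norm x * (1/2) ^ k" for k
    proof (induction k)
      case (Suc k)
      then show ?case using pqd[of "r k"] by (simp add: r_Suc)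
    qed (simp add: r_def)
    have geo: "(\<lambda>k. C * (norm x * (1/2) ^ k)) sums (C * (norm x * 2))"
      using geometric_sums[of "1/2::real"] by (intro sums_mult) simp
    have pqb: "norm (p (r k)) + norm (q (r k)) \<le> C * (norm x * (1/2) ^ k)" for k
      using pqn[of "r k"] mult_left_mono[OF r_norm[of k] C] by linarith
    have bp: "norm (p (r k)) \<le> C * (norm x * (1/2) ^ k)" 
      and bq: "norm (q (r k)) \<le> C * (norm x * (1/2) ^ k)" for k
      using pqb[of k] norm_ge_zero[of "p (r k)"] norm_ge_zero[of "q (r k)"] by linarith+
    have sp: "summable (\<lambda>k. norm (p (r k)))" and sq: "summable (\<lambda>k. norm (q (r k)))"
      using bp bq
      by (auto intro!: summable_comparison_test'[OF sums_summable[OF geo], where N = 0])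
    define u v where "u = (\<Sum>k. p (r k))" and "v = (\<Sum>k. q (r k))"
    have u: "(\<lambda>k. p (r k)) sums u" and v: "(\<lambda>k. q (r k)) sums v"
      unfolding u_def v_def using sp sq by (auto intro: summable_sums summable_norm_cancel)
    have "(\<lambda>k. r k - r (Suc k)) sums (r 0 - 0)"
    proof (rule telescope_sums')
      have "(\<lambda>k. norm x * (1/2) ^ k) \<longlonglongrightarrow> norm x * 0"
        by (intro tendsto_mult tendsto_const LIMSEQ_realpow_zero) auto
      then have "(\<lambda>k. norm x * (1/2) ^ k) \<longlonglongrightarrow> 0" by simp
      then show "r \<longlonglongrightarrow> 0" using r_norm by (intro Lim_null_comparison[of r]) auto
    qed
    moreover have "(\<lambda>k. r k - r (Suc k)) = (\<lambda>k. p (r k) - q (r k))" by (simp add: r_Suc)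
    moreover have "r 0 = x" by (simp add: r_def)
    ultimately have "(\<lambda>k. p (r k) - q (r k)) sums x" by simp
    then have "x = u - v" using sums_unique2 sums_diff[OF u v] by blast
    moreover have "0 \<le> u" "0 \<le> v" using u v p q by (auto intro: nonneg_suminf)
    moreover have "norm u + norm v \<le> (2 * C + 1) * norm x"
    proof -
      have "norm u + norm v \<le> (\<Sum>k. norm (p (r k))) + (\<Sum>k. norm (q (r k)))"
        unfolding u_def v_def using sp sq by (intro add_mono summable_norm)
      also have "\<dots> = (\<Sum>k. norm (p (r k)) + norm (q (r k)))" using sp sq by (rule suminf_add)
      also have "\<dots> \<le> C * (norm x * 2)"
        using pqb sp sq by (subst sums_unique[OF geo]) (intro suminf_le summable_add sums_summable[OF geo])
      also have "\<dots> \<le> (2 * C + 1) * norm x" by (simp add: algebra_simps)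
      finally show ?thesis .
    qed
    ultimately show ?thesis by blast
  qed
  \<comment> \<open>The geometric series yields \<open>2 * C\<close>; the summand 1 makes the
    constant positive even if \<open>C = 0\<close>.\<close>
  then show ?thesis using C by (intro exI[of _ "2 * C + 1"]) auto
qed

text \<open>A choice that depends on the type only, so that all semigroups, resolvents and
  approximants share the same bound.\<close>

definition decomposition_constant :: "'a::abstract_state_space itself \<Rightarrow> real" where
  "decomposition_constant _ = (SOME M. M > 0 \<and> (\<forall>x::'a. \<exists>u v.
     0 \<le> u \<and> 0 \<le> v \<and> x = u - v \<and> norm u + norm v \<le> M * norm x))"

lemma decomposition_constant_pos: "decomposition_constant TYPE('a::abstract_state_space) > 0"
  and bounded_decomposition:
    "\<exists>u v. 0 \<le> u \<and> 0 \<le> v \<and> x = u - v \<and>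
       norm u + norm v \<le> decomposition_constant TYPE('a) * norm (x::'a::abstract_state_space)"
  using someI_ex[OF ex_bounded_decomposition[where 'a = 'a]]
  unfolding decomposition_constant_def by blast+

text \<open>The passage from the cone to the whole space: every norm bound for a substochastic
  operator is obtained from positive vectors in this way.\<close>

lemma norm_le_of_nonneg_bound:
  fixes f :: "'a::abstract_state_space \<Rightarrow> 'b::real_normed_vector"
  assumes "linear f" "0 \<le> c" "\<And>u. 0 \<le> u \<Longrightarrow> norm (f u) \<le> c * norm u"
  shows "norm (f x) \<le> decomposition_constant TYPE('a) * c * norm x"
proof -
  obtain u v where uv: "0 \<le> u" "0 \<le> v" "x = u - v"
    "norm u + norm v \<le> decomposition_constant TYPE('a) * norm x"
    using bounded_decomposition by blast
  have "norm (f x) \<le> norm (f u) + norm (f v)"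
    unfolding uv(3) linear_diff[OF assms(1)] by (rule norm_triangle_ineq4)
  also have "\<dots> \<le> c * (norm u + norm v)" using assms(3) uv by (simp add: distrib_left add_mono)
  also have "\<dots> \<le> c * (decomposition_constant TYPE('a) * norm x)"
    using uv(4) assms(2) by (rule mult_left_mono)
  finally show ?thesis by (simp add: mult_ac)
qed

lemma substochastic_norm_le:
  fixes T :: "'a::abstract_state_space \<Rightarrow>\<^sub>L 'a"
  assumes "substochastic T"
  shows "norm (blinfun_apply T x) \<le> decomposition_constant TYPE('a) * norm x"
  using assms norm_le_of_nonneg_bound[of "blinfun_apply T" 1 x]
  by (simp add: substochastic_def bounded_linear.linear[OF blinfun.bounded_linear_right])

section \<open>Substochastic semigroups and their generators\<close>

lemma has_vector_derivative_within_alt: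
  "(f has_vector_derivative d) (at x within S) \<longleftrightarrow>
    (\<forall>e>0. \<exists>\<delta>>0. \<forall>y\<in>S. \<bar>y - x\<bar> < \<delta> \<longrightarrow> norm (f y - f x - (y - x) *\<^sub>R d) \<le> e * \<bar>y - x\<bar>)"
  by (simp add: has_vector_derivative_def has_derivative_within_alt bounded_linear_scaleR_left)

text \<open>A product rule for operator families that are differentiable only strongly, and only at
  the vector \<open>F s\<close>; an operator-norm derivative does not exist when the generator is
  unbounded. The increment splits into \<open>U r\<close> on the remainder of \<open>F\<close>
  (uniform bound), the increment of \<open>U\<close> at the fixed vector \<open>F s\<close>, and the
  increment of \<open>U\<close> at \<open>F'\<close> (strong continuity).\<close>

lemma has_vector_derivative_blinfun_family:
  fixes U :: "real \<Rightarrow> 'a::real_normed_vector \<Rightarrow>\<^sub>L 'b::real_normed_vector"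
  assumes F: "(F has_vector_derivative F') (at s within S)"
    and U: "((\<lambda>r. U r (F s)) has_vector_derivative y) (at s within S)"
    and bnd: "\<And>r x. r \<in> S \<Longrightarrow> norm (U r x) \<le> K * norm x"
    and cont: "((\<lambda>r. U r F') \<longlongrightarrow> U s F') (at s within S)"
  shows "((\<lambda>r. U r (F r)) has_vector_derivative (y + U s F')) (at s within S)"
  unfolding has_vector_derivative_within_alt
proof (intro allI impI)
  fix e :: real assume e: "e > 0"
  define e1 where "e1 = e / (3 * (\<bar>K\<bar> + 1))"
  have e1: "e1 > 0" using e by (simp add: e1_def)
  obtain d1 where d1: "d1 > 0" "\<And>r. r \<in> S \<Longrightarrow> \<bar>r - s\<bar> < d1 \<Longrightarrow>
      norm (F r - F s - (r - s) *\<^sub>R F') \<le> e1 * \<bar>r - s\<bar>"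
    using F e1 unfolding has_vector_derivative_within_alt by metis
  obtain d2 where d2: "d2 > 0" "\<And>r. r \<in> S \<Longrightarrow> \<bar>r - s\<bar> < d2 \<Longrightarrow>
      norm (U r (F s) - U s (F s) - (r - s) *\<^sub>R y) \<le> e / 3 * \<bar>r - s\<bar>"
    using U e unfolding has_vector_derivative_within_alt by (metis divide_pos_pos zero_less_numeral)
  have "\<exists>d>0. \<forall>r\<in>S. r \<noteq> s \<and> dist r s < d \<longrightarrow> dist (U r F') (U s F') < e / 3"
    using cont e unfolding tendsto_iff eventually_at by (metis divide_pos_pos zero_less_numeral)
  then obtain d3 where d3: "d3 > 0"
    "\<And>r. r \<in> S \<Longrightarrow> r \<noteq> s \<Longrightarrow> dist r s < d3 \<Longrightarrow> dist (U r F') (U s F') < e / 3"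
    by metis
  show "\<exists>d>0. \<forall>r\<in>S. \<bar>r - s\<bar> < d \<longrightarrow>
      norm (U r (F r) - U s (F s) - (r - s) *\<^sub>R (y + U s F')) \<le> e * \<bar>r - s\<bar>"
  proof (intro exI[of _ "min d1 (min d2 d3)"] conjI ballI impI)
    fix r assume r: "r \<in> S" "\<bar>r - s\<bar> < min d1 (min d2 d3)"
    have "norm (U r (F r - F s - (r - s) *\<^sub>R F')) \<le> K * norm (F r - F s - (r - s) *\<^sub>R F')"
      by (rule bnd[OF r(1)])
    also have "\<dots> \<le> (\<bar>K\<bar> + 1) * (e1 * \<bar>r - s\<bar>)"
      using d1(2)[of r] r by (intro mult_mono) auto
    also have "\<dots> = e / 3 * \<bar>r - s\<bar>" using e by (simp add: e1_def field_simps)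
    finally have 1: "norm (U r (F r - F s - (r - s) *\<^sub>R F')) \<le> e / 3 * \<bar>r - s\<bar>" .
    have 2: "norm (U r (F s) - U s (F s) - (r - s) *\<^sub>R y) \<le> e / 3 * \<bar>r - s\<bar>"
      using d2(2) r by auto
    have 3: "norm ((r - s) *\<^sub>R (U r F' - U s F')) \<le> e / 3 * \<bar>r - s\<bar>"
    proof (cases "r = s")
      case False
      then have "norm (U r F' - U s F') \<le> e / 3"
        using d3(2)[OF r(1) False] r(2) by (auto simp: dist_norm)
      then show ?thesis
        using mult_left_mono[of "norm (U r F' - U s F')" "e / 3" "\<bar>r - s\<bar>"] by (simp add: mult.commute)
    qed auto
    have eq: "U r (F r) - U s (F s) - (r - s) *\<^sub>R (y + U s F') =
        U r (F r - F s - (r - s) *\<^sub>R F') + (U r (F s) - U s (F s) - (r - s) *\<^sub>R y) +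
        (r - s) *\<^sub>R (U r F' - U s F')"
      by (simp add: blinfun.bilinear_simps algebra_simps)
    have "norm (U r (F r) - U s (F s) - (r - s) *\<^sub>R (y + U s F')) \<le>
        e / 3 * \<bar>r - s\<bar> + e / 3 * \<bar>r - s\<bar> + e / 3 * \<bar>r - s\<bar>"
      unfolding eq using 1 2 3 by (intro norm_triangle_mono)
    then show "norm (U r (F r) - U s (F s) - (r - s) *\<^sub>R (y + U s F')) \<le> e * \<bar>r - s\<bar>"
      by simp
  qed (use d1 d2 d3 in auto)
qed

locale substochastic_generation =
  fixes D :: "'a::abstract_state_space set" and A :: "'a \<Rightarrow> 'a" and T :: "real \<Rightarrow> 'a \<Rightarrow>\<^sub>L 'a"
  assumes substochastic_semigroup: "substochastic_semigroup T" and generates: "generates D A T"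
begin

lemma T_0 [simp]: "T 0 = id_blinfun"
  and T_extensional: "T \<in> extensional {0..}"
  and T_substochastic: "0 \<le> t \<Longrightarrow> substochastic (T t)"
  and T_add: "0 \<le> s \<Longrightarrow> 0 \<le> t \<Longrightarrow> blinfun_apply (T (s + t)) x = T s (T t x)"
  and T_tendsto_0: "((\<lambda>t. blinfun_apply (T t) x) \<longlongrightarrow> x) (at_right 0)"
  using substochastic_semigroup by (auto simp: substochastic_semigroup_def C0_semigroup_def)

lemma T_nonneg: "0 \<le> t \<Longrightarrow> 0 \<le> u \<Longrightarrow> 0 \<le> T t u"
  and T_norm_nonneg: "0 \<le> t \<Longrightarrow> 0 \<le> u \<Longrightarrow> norm (T t u) \<le> norm u"
  using T_substochastic by (auto simp: substochastic_def)

lemma T_norm: "0 \<le> t \<Longrightarrow> norm (T t x) \<le> decomposition_constant TYPE('a) * norm x"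
  using T_substochastic by (rule substochastic_norm_le)

lemma T_continuous: "continuous_on {0..} (\<lambda>t. T t x)"
  unfolding continuous_on_iff
proof (intro ballI allI impI)
  fix t e :: real assume t: "t \<in> {0..}" and e: "e > 0"
  have "e / decomposition_constant TYPE('a) > 0" using e decomposition_constant_pos[where 'a='a] by simp
  then have "eventually (\<lambda>h. dist (T h x) x < e / decomposition_constant TYPE('a)) (at_right 0)"
    using T_tendsto_0 unfolding tendsto_iff by blast
  then obtain d where d: "d > 0" "\<And>h. 0 < h \<Longrightarrow> h < d \<Longrightarrow> dist (T h x) x < e / decomposition_constant TYPE('a)"
    unfolding eventually_at_right_field by auto
  have *: "norm (T b x - T a x) < e" if "0 \<le> a" "a < b" "b - a < d" for a b
  proof -
    have "T b x - T a x = T a (T (b - a) x - x)"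
      using T_add[of a "b - a" x] that by (simp add: blinfun.diff_right)
    then have "norm (T b x - T a x) \<le> decomposition_constant TYPE('a) * norm (T (b - a) x - x)" using T_norm that by simp
    also have "\<dots> < decomposition_constant TYPE('a) * (e / decomposition_constant TYPE('a))"
      using d(2)[of "b - a"] that decomposition_constant_pos[where 'a='a] by (intro mult_strict_left_mono) (auto simp: dist_norm)
    finally show ?thesis using decomposition_constant_pos[where 'a='a] by simp
  qed
  show "\<exists>d>0. \<forall>s\<in>{0..}. dist s t < d \<longrightarrow> dist (T s x) (T t x) < e"
  proof (intro exI[of _ d] conjI ballI impI)
    fix s assume s: "s \<in> {0..}" "dist s t < d"
    show "dist (T s x) (T t x) < e"
      using *[of s t] *[of t s] s t e
      by (cases s t rule: linorder_cases) (auto simp: dist_norm norm_minus_commute)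
  qed (rule d)
qed

lemma D_eq: "D = generator_domain T"
  and A_eq: "x \<in> D \<Longrightarrow> A x = generator T x"
  using generates by (auto simp: generates_def)

lemma generator_tendsto:
  assumes "x \<in> D"
  shows "((\<lambda>h. (T h x - x) /\<^sub>R h) \<longlongrightarrow> A x) (at_right 0)"
proof -
  obtain y where y: "((\<lambda>h. (T h x - x) /\<^sub>R h) \<longlongrightarrow> y) (at_right 0)"
    using assms unfolding D_eq generator_domain_def by blast
  then have "A x = y"
    unfolding A_eq[OF assms] generator_def by (intro tendsto_Lim) auto
  then show ?thesis using y by simp
qed

lemma generatorI:
  assumes "((\<lambda>h. (T h x - x) /\<^sub>R h) \<longlongrightarrow> y) (at_right 0)"
  shows "x \<in> D" "A x = y"
proof -
  show "x \<in> D" using assms unfolding D_eq generator_domain_def by blast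
  then show "A x = y"
    using generator_tendsto assms tendsto_unique trivial_limit_at_right_real by blast
qed

lemma generatorI_derivative:
  assumes "((\<lambda>h. T h x) has_vector_derivative y) (at 0 within {0..})"
  shows "x \<in> D" "A x = y"
proof -
  have "((\<lambda>h. (T h x - x) /\<^sub>R h) \<longlongrightarrow> y) (at_right 0)"
    unfolding tendsto_iff
  proof (intro allI impI)
    fix e :: real assume "e > 0"
    then obtain d where d: "d > 0" "\<And>h. 0 \<le> h \<Longrightarrow> h < d \<Longrightarrow> norm (T h x - x - h *\<^sub>R y) \<le> e / 2 * h"
      using assms[unfolded has_vector_derivative_within_alt, rule_format, of "e / 2"] by force
    have "dist ((T h x - x) /\<^sub>R h) y < e" if h: "0 < h" "h < d" for h
    proof -
      have "T h x - x - h *\<^sub>R y = h *\<^sub>R ((T h x - x) /\<^sub>R h - y)"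
        using h by (simp add: scaleR_diff_right)
      then have "norm ((T h x - x) /\<^sub>R h - y) * h = norm (T h x - x - h *\<^sub>R y)"
        using h by simp
      also have "\<dots> \<le> e / 2 * h" using d(2) h by simp
      finally show ?thesis using h \<open>e > 0\<close> by (simp add: dist_norm)
    qed
    then show "eventually (\<lambda>h. dist ((T h x - x) /\<^sub>R h) y < e) (at_right 0)"
      using d(1) unfolding eventually_at_right_field by auto
  qed
  then show "x \<in> D" "A x = y" by (fact generatorI)+
qed

lemma subspace_D: "subspace D"
  and A_add: "x \<in> D \<Longrightarrow> y \<in> D \<Longrightarrow> A (x + y) = A x + A y"
  and A_scaleR: "x \<in> D \<Longrightarrow> A (c *\<^sub>R x) = c *\<^sub>R A x"
proof -
  have add: "x + y \<in> D \<and> A (x + y) = A x + A y" if "x \<in> D" "y \<in> D" for x y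
    using tendsto_add[OF generator_tendsto[OF that(1)] generator_tendsto[OF that(2)]]
    by (intro conjI generatorI) (simp_all add: blinfun.bilinear_simps algebra_simps)
  have scale: "c *\<^sub>R x \<in> D \<and> A (c *\<^sub>R x) = c *\<^sub>R A x" if "x \<in> D" for x c
    using tendsto_scaleR[OF tendsto_const generator_tendsto[OF that], of c]
    by (intro conjI generatorI) (simp_all add: blinfun.bilinear_simps algebra_simps)
  have "0 \<in> D" by (intro generatorI[where y = 0]) (simp add: blinfun.bilinear_simps)
  then show "subspace D" using add scale unfolding subspace_def by blast
  show "x \<in> D \<Longrightarrow> y \<in> D \<Longrightarrow> A (x + y) = A x + A y" using add by blast
  show "x \<in> D \<Longrightarrow> A (c *\<^sub>R x) = c *\<^sub>R A x" using scale by blast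
qed

lemma A_diff: "x \<in> D \<Longrightarrow> y \<in> D \<Longrightarrow> A (x - y) = A x - A y"
  using A_add[of x "(-1) *\<^sub>R y"] A_scaleR[of y "-1"] subspace_D
  by (simp add: subspace_neg)

lemma T_generator:
  assumes "x \<in> D" "0 \<le> t"
  shows "T t x \<in> D" "A (T t x) = T t (A x)"
proof -
  have "((\<lambda>h. T t ((T h x - x) /\<^sub>R h)) \<longlongrightarrow> T t (A x)) (at_right 0)"
    by (intro tendsto_intros generator_tendsto assms)
  moreover have "eventually (\<lambda>h. T t ((T h x - x) /\<^sub>R h) = (T h (T t x) - T t x) /\<^sub>R h) (at_right 0)"
    unfolding eventually_at_right_field
  proof (intro exI[of _ 1] conjI allI impI)
    fix h :: real assume "0 < h" "h < 1"
    then have "T h (T t x) = T t (T h x)"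
      using T_add[of h t x] T_add[of t h x] assms(2) by (simp add: add.commute)
    then show "T t ((T h x - x) /\<^sub>R h) = (T h (T t x) - T t x) /\<^sub>R h"
      by (simp add: blinfun.bilinear_simps)
  qed simp
  ultimately have "((\<lambda>h. (T h (T t x) - T t x) /\<^sub>R h) \<longlongrightarrow> T t (A x)) (at_right 0)"
    using tendsto_cong by fast
  then show "T t x \<in> D" "A (T t x) = T t (A x)" by (fact generatorI)+
qed

lemma generator_estimate:
  assumes "x \<in> D" "e > 0"
  obtains d where "d > 0" "\<And>h. 0 \<le> h \<Longrightarrow> h < d \<Longrightarrow> norm (T h x - x - h *\<^sub>R A x) \<le> e * h"
proof -
  have "eventually (\<lambda>h. dist ((T h x - x) /\<^sub>R h) (A x) < e) (at_right 0)"
    using generator_tendsto[OF assms(1)] assms(2) unfolding tendsto_iff by blast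
  then obtain d where d: "d > 0" "\<And>h. 0 < h \<Longrightarrow> h < d \<Longrightarrow> norm ((T h x - x) /\<^sub>R h - A x) < e"
    unfolding eventually_at_right_field by (auto simp: dist_norm)
  have "norm (T h x - x - h *\<^sub>R A x) \<le> e * h" if h: "0 \<le> h" "h < d" for h
  proof (cases "h = 0")
    case False
    have "T h x - x - h *\<^sub>R A x = h *\<^sub>R ((T h x - x) /\<^sub>R h - A x)"
      using False by (simp add: scaleR_diff_right)
    then have "norm (T h x - x - h *\<^sub>R A x) = h * norm ((T h x - x) /\<^sub>R h - A x)"
      using h by (metis abs_of_nonneg norm_scaleR)
    also have "\<dots> \<le> h * e" using d(2)[of h] h False by (intro mult_left_mono) auto
    finally show ?thesis by (simp add: mult.commute)
  qed simp
  with d(1) show ?thesis by (rule that)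
qed

lemma T_has_vector_derivative:
  assumes x: "x \<in> D" and t: "0 \<le> t"
  shows "((\<lambda>t. T t x) has_vector_derivative T t (A x)) (at t within {0..})"
  unfolding has_vector_derivative_within_alt
proof (intro allI impI)
  fix e :: real assume e: "e > 0"
  obtain d where d: "d > 0"
    "\<And>h. 0 \<le> h \<Longrightarrow> h < d \<Longrightarrow> norm (T h x - x - h *\<^sub>R A x) \<le> e / (2 * decomposition_constant TYPE('a)) * h"
    using generator_estimate[OF x] e decomposition_constant_pos[where 'a='a] by (metis divide_pos_pos mult_pos_pos zero_less_numeral)
  obtain d' where d': "d' > 0"
    "\<And>s. 0 \<le> s \<Longrightarrow> dist s t < d' \<Longrightarrow> dist (T s (A x)) (T t (A x)) < e / 2"
    using T_continuous[of "A x", unfolded continuous_on_iff, rule_format, of t "e / 2"] t e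
    by auto
  have *: "norm (T a (T h x - x - h *\<^sub>R A x)) \<le> e / 2 * h" if "0 \<le> a" "0 \<le> h" "h < d" for a h
  proof -
    have "norm (T a (T h x - x - h *\<^sub>R A x)) \<le> decomposition_constant TYPE('a) * norm (T h x - x - h *\<^sub>R A x)"
      using that by (intro T_norm)
    also have "\<dots> \<le> decomposition_constant TYPE('a) * (e / (2 * decomposition_constant TYPE('a)) * h)"
      using d(2) that decomposition_constant_pos[where 'a='a] by (intro mult_left_mono) auto
    finally show ?thesis using decomposition_constant_pos[where 'a='a] by simp
  qed
  show "\<exists>d>0. \<forall>s\<in>{0..}. \<bar>s - t\<bar> < d \<longrightarrow>
      norm (T s x - T t x - (s - t) *\<^sub>R T t (A x)) \<le> e * \<bar>s - t\<bar>"
  proof (intro exI[of _ "min d d'"] conjI ballI impI)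
    fix s assume s: "s \<in> {0..}" "\<bar>s - t\<bar> < min d d'"
    show "norm (T s x - T t x - (s - t) *\<^sub>R T t (A x)) \<le> e * \<bar>s - t\<bar>"
    proof (cases "t \<le> s")
      case True
      then have "T s x - T t x - (s - t) *\<^sub>R T t (A x) = T t (T (s - t) x - x - (s - t) *\<^sub>R A x)"
        using T_add[of t "s - t" x] t by (simp add: blinfun.bilinear_simps)
      then have "norm (T s x - T t x - (s - t) *\<^sub>R T t (A x)) \<le> e / 2 * (s - t)"
        using *[of t "s - t"] True t s by auto
      also have "\<dots> \<le> e * \<bar>s - t\<bar>" using e True by (intro mult_mono) auto
      finally show ?thesis .
    next
      case False
      \<comment> \<open>To the left of \<open>t\<close> only \<open>T s\<close> can be factored out,
        which produces the slope \<open>T s (A x)\<close>; strong continuity at \<open>A x\<close>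
        turns it into \<open>T t (A x)\<close>.\<close>
      then have eq: "T s x - T t x - (s - t) *\<^sub>R T t (A x) =
          (t - s) *\<^sub>R (T t (A x) - T s (A x)) - T s (T (t - s) x - x - (t - s) *\<^sub>R A x)"
        using T_add[of s "t - s" x] s by (simp add: blinfun.bilinear_simps algebra_simps)
      have "norm ((t - s) *\<^sub>R (T t (A x) - T s (A x))) \<le> (t - s) * (e / 2)"
        using d'(2)[of s] s False by (auto simp: dist_norm norm_minus_commute intro!: mult_left_mono)
      moreover have "norm (T s (T (t - s) x - x - (t - s) *\<^sub>R A x)) \<le> e / 2 * (t - s)"
        using *[of s "t - s"] s False by auto
      ultimately have "norm (T s x - T t x - (s - t) *\<^sub>R T t (A x)) \<le>
          (t - s) * (e / 2) + e / 2 * (t - s)"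
        unfolding eq by (intro order_trans[OF norm_triangle_ineq4] add_mono)
      then show ?thesis using False by (simp add: algebra_simps)
    qed
  qed (use d d' in auto)
qed

section \<open>Orbit integrals, the Laplace transform and the resolvent\<close>

definition orbit_integral :: "real \<Rightarrow> 'a \<Rightarrow> real \<Rightarrow> 'a" where
  "orbit_integral l x t = integral {0..t} (\<lambda>s. exp (- l * s) *\<^sub>R T s x)"

lemma orbit_continuous: "S \<subseteq> {0..} \<Longrightarrow> continuous_on S (\<lambda>s. exp (- l * s) *\<^sub>R T s x)"
  by (intro continuous_intros continuous_on_subset[OF T_continuous])

lemma orbit_integrable: "0 \<le> a \<Longrightarrow> (\<lambda>s. exp (- l * s) *\<^sub>R T s x) integrable_on {a..b}"
  by (intro integrable_continuous_real orbit_continuous) auto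

lemma orbit_integral_diff:
  assumes "0 \<le> a" "a \<le> b"
  shows "orbit_integral l x b - orbit_integral l x a = integral {a..b} (\<lambda>s. exp (- l * s) *\<^sub>R T s x)"
  unfolding orbit_integral_def
  using Henstock_Kurzweil_Integration.integral_combine[OF assms orbit_integrable[where l = l and x = x]]
  by (simp add: algebra_simps)

lemma orbit_integral_diff_norm:
  assumes "0 \<le> l" "0 \<le> a" "a \<le> b"
  shows "norm (orbit_integral l x b - orbit_integral l x a) \<le>
    exp (- l * a) * (decomposition_constant TYPE('a) * norm x) * (b - a)"
  unfolding orbit_integral_diff[OF assms(2,3)]
proof (rule integral_bound)
  fix t assume t: "t \<in> {a..b}"
  have "norm (exp (- l * t) *\<^sub>R T t x) = exp (- l * t) * norm (T t x)" by simp
  also have "\<dots> \<le> exp (- l * a) * (decomposition_constant TYPE('a) * norm x)"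
    using t assms T_norm[of t x] by (intro mult_mono) (auto intro: mult_left_mono)
  finally show "norm (exp (- l * t) *\<^sub>R T t x) \<le> exp (- l * a) * (decomposition_constant TYPE('a) * norm x)" .
qed (use assms in \<open>auto intro: orbit_continuous[of _ l, simplified]\<close>)

lemma T_orbit_integral:
  assumes "0 \<le> h" "0 \<le> t"
  shows "T h (orbit_integral l x t) = exp (l * h) *\<^sub>R (orbit_integral l x (t + h) - orbit_integral l x h)"
proof -
  define f where "f = (\<lambda>s. exp (- l * s) *\<^sub>R T s x)"
  have "T h (orbit_integral l x t) = integral {0..t} (\<lambda>s. T h (f s))"
    unfolding orbit_integral_def f_def
    by (subst integral_linear[symmetric, OF orbit_integrable blinfun.bounded_linear_right]) (auto simp: o_def)
  also have "\<dots> = integral {0..t} (\<lambda>s. exp (l * h) *\<^sub>R f (s + h))"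
  proof (rule integral_cong)
    fix s assume "s \<in> {0..t}"
    then have "T (s + h) x = T h (T s x)" using T_add[of h s x] assms by (simp add: add.commute)
    then show "T h (f s) = exp (l * h) *\<^sub>R f (s + h)"
      by (simp add: f_def blinfun.scaleR_right algebra_simps flip: exp_add)
  qed
  also have "\<dots> = exp (l * h) *\<^sub>R integral {0..t} (f \<circ> (+) h)"
    by (simp add: o_def add.commute)
  also have "integral {0..t} (f \<circ> (+) h) = integral {h..t + h} f"
    using integral_shift_Icc_real[of 0 t f h] by simp
  also have "\<dots> = orbit_integral l x (t + h) - orbit_integral l x h"
    using orbit_integral_diff[of h "t + h" l x] assms by (simp add: f_def)
  finally show ?thesis .
qed

lemma orbit_integral_has_vector_derivative:
  assumes "0 \<le> t"
  shows "((\<lambda>t. orbit_integral l x t) has_vector_derivative exp (- l * t) *\<^sub>R T t x) (at t within {0..})"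
proof -
  have "((\<lambda>t. orbit_integral l x t) has_vector_derivative exp (- l * t) *\<^sub>R T t x) (at t within {0..t+1})"
    unfolding orbit_integral_def using assms
    by (intro integral_has_vector_derivative orbit_continuous) auto
  moreover have "at t within {0..t+1} = at t within {0..}"
    by (rule at_within_nhd[of t "{..<t+1}"]) auto
  ultimately show ?thesis by simp
qed

text \<open>Differentiates a formula for \<open>T h y\<close> at \<open>h = 0\<close>. It serves two
  cases: \<open>l = 0\<close> with \<open>g\<close> the increment of the orbit integral at
  \<open>t\<close>, which treats integrals over \<open>{0..t}\<close>, and \<open>l > 0\<close> with
  \<open>g = 0\<close>, which treats the Laplace transform.\<close>

lemma orbit_integral_generator_aux:
  assumes g: "(g has_vector_derivative g') (at 0 within {0..})" "g 0 = 0"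
    and y: "\<And>h. 0 \<le> h \<Longrightarrow> T h y = exp (l * h) *\<^sub>R (y + g h - orbit_integral l x h)"
  shows "y \<in> D" "A y = l *\<^sub>R y + g' - x"
proof -
  have F0: "orbit_integral l x 0 = 0" by (simp add: orbit_integral_def)
  have "((\<lambda>h. exp (l * h) *\<^sub>R (y + g h - orbit_integral l x h)) has_vector_derivative (l *\<^sub>R y + g' - x))
      (at 0 within {0..})"
    using F0 g(2)
    by (auto intro!: derivative_eq_intros g(1) orbit_integral_has_vector_derivative[of 0 l x]
        simp: algebra_simps)
  then have "((\<lambda>h. T h y) has_vector_derivative (l *\<^sub>R y + g' - x)) (at 0 within {0..})"
    by (rule has_vector_derivative_transform[rotated 2]) (simp_all add: y del: T_0)
  then show "y \<in> D" "A y = l *\<^sub>R y + g' - x" by (fact generatorI_derivative)+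
qed

lemma integral_generator:
  assumes "0 \<le> t"
  shows "integral {0..t} (\<lambda>s. T s x) \<in> D" "A (integral {0..t} (\<lambda>s. T s x)) = T t x - x"
proof -
  let ?F = "orbit_integral 0 x"
  have "((\<lambda>h. ?F (t + h)) has_vector_derivative T t x) (at 0 within {0..})"
  proof -
    have "(?F has_vector_derivative T t x) (at (t + 0) within (\<lambda>h. t + h) ` {0..})"
      using orbit_integral_has_vector_derivative[OF assms, of 0 x] assms
      by (auto intro: has_vector_derivative_within_subset)
    moreover have "((\<lambda>h. t + h) has_vector_derivative 1) (at 0 within {0..})"
      by (auto intro!: derivative_eq_intros)
    ultimately show ?thesis
      using vector_diff_chain_within[of "\<lambda>h. t + h" 1 0 "{0..}" ?F "T t x"] by (simp add: o_def)
  qed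
  then have "((\<lambda>h. ?F (t + h) - ?F t) has_vector_derivative T t x) (at 0 within {0..})"
    by (auto intro!: derivative_eq_intros)
  moreover have "T h (?F t) = exp (0 * h) *\<^sub>R (?F t + (?F (t + h) - ?F t) - ?F h)" if "0 \<le> h" for h
    using T_orbit_integral[OF that assms, of 0 x] by simp
  ultimately have "?F t \<in> D" "A (?F t) = 0 *\<^sub>R ?F t + T t x - x"
    using orbit_integral_generator_aux[of "\<lambda>h. ?F (t + h) - ?F t" "T t x" "?F t" 0 x] by auto
  moreover have "?F t = integral {0..t} (\<lambda>s. T s x)" by (simp add: orbit_integral_def)
  ultimately show "integral {0..t} (\<lambda>s. T s x) \<in> D" "A (integral {0..t} (\<lambda>s. T s x)) = T t x - x"
    by auto
qed

text \<open>Together with \<open>integral_generator\<close> this approximates any vector by elements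
  of \<open>D\<close>, and elements of \<open>D\<close> even in the graph norm, since
  \<open>A\<close> maps the mean to a difference quotient of the orbit.\<close>

lemma integral_mean_tendsto:
  "((\<lambda>t. integral {0..t} (\<lambda>s. T s x) /\<^sub>R t) \<longlongrightarrow> x) (at_right 0)"
  unfolding tendsto_iff
proof (intro allI impI)
  fix e :: real assume e: "e > 0"
  obtain d where d: "d > 0" "\<And>t. 0 \<le> t \<Longrightarrow> t < d \<Longrightarrow>
      norm (orbit_integral 0 x t - t *\<^sub>R x) \<le> e / 2 * t"
    using orbit_integral_has_vector_derivative[of 0 0 x, unfolded has_vector_derivative_within_alt,
        rule_format, of "e / 2"] e
    by (auto simp: orbit_integral_def)
  have "dist (integral {0..t} (\<lambda>s. T s x) /\<^sub>R t) x < e" if t: "0 < t" "t < d" for t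
  proof -
    have "orbit_integral 0 x t - t *\<^sub>R x = t *\<^sub>R (integral {0..t} (\<lambda>s. T s x) /\<^sub>R t - x)"
      using t by (simp add: scaleR_diff_right orbit_integral_def)
    then have "norm (integral {0..t} (\<lambda>s. T s x) /\<^sub>R t - x) * t \<le> e / 2 * t"
      using d(2)[of t] t by (simp add: mult.commute)
    then show ?thesis using t e by (simp add: dist_norm)
  qed
  then show "eventually (\<lambda>t. dist (integral {0..t} (\<lambda>s. T s x) /\<^sub>R t) x < e) (at_right 0)"
    using d(1) unfolding eventually_at_right_field by auto
qed

lemma closure_D: "closure D = UNIV"
proof -
  have "x \<in> closure D" for x
  proof (rule Lim_in_closed_set[OF closed_closure _ _ integral_mean_tendsto])
    show "eventually (\<lambda>t. integral {0..t} (\<lambda>s. T s x) /\<^sub>R t \<in> closure D) (at_right 0)"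
      unfolding eventually_at_right_field
      using integral_generator(1) subspace_D closure_subset
      by (intro exI[of _ 1]) (auto intro!: subspace_scale subsetD[OF closure_subset])
  qed simp
  then show ?thesis by auto
qed

lemma T_reversed_has_vector_derivative:
  assumes "x \<in> D" "s \<in> {0..t}"
  shows "((\<lambda>s. T (t - s) x) has_vector_derivative - T (t - s) (A x)) (at s within {0..t})"
proof -
  have "((\<lambda>s. T s x) has_vector_derivative T (t - s) (A x)) (at (t - s) within (\<lambda>s. t - s) ` {0..t})"
    using T_has_vector_derivative[OF assms(1), of "t - s"] assms(2)
    by (auto intro: has_vector_derivative_within_subset)
  moreover have "((\<lambda>s. t - s) has_vector_derivative -1) (at s within {0..t})"
    by (auto intro!: derivative_eq_intros)
  ultimately show ?thesis
    using vector_diff_chain_within[of "\<lambda>s. t - s" "-1" s "{0..t}" "\<lambda>s. T s x"] by (simp add: o_def)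
qed

text \<open>Interpolating by \<open>s \<mapsto> T (t - s) (U s x)\<close>, whose derivative vanishes.\<close>

lemma semigroup_eqI:
  assumes "substochastic_generation D A U"
  shows "T = U"
proof -
  interpret U: substochastic_generation D A U by fact
  have eq: "T t x = U t x" if t: "0 \<le> t" and x: "x \<in> D" for t x
  proof -
    define g where "g s = T (t - s) (U s x)" for s
    have "(g has_vector_derivative 0) (at s within {0..t})" if s: "s \<in> {0..t}" for s
    proof -
      have Us: "U s x \<in> D" "A (U s x) = U s (A x)"
        using x s U.T_generator by auto
      have "(g has_vector_derivative (- T (t - s) (A (U s x)) + T (t - s) (U s (A x)))) (at s within {0..t})"
        unfolding g_def
      proof (rule has_vector_derivative_blinfun_family)
        show "((\<lambda>s. U s x) has_vector_derivative U s (A x)) (at s within {0..t})"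
          using U.T_has_vector_derivative[of x s] x s
          by (auto intro: has_vector_derivative_within_subset)
        show "((\<lambda>r. T (t - r) (U s x)) has_vector_derivative - T (t - s) (A (U s x))) (at s within {0..t})"
          using Us(1) s by (rule T_reversed_has_vector_derivative)
        show "norm (T (t - r) z) \<le> decomposition_constant TYPE('a) * norm z" if "r \<in> {0..t}" for r z
          using that by (intro T_norm) auto
        have "continuous_on {0..t} (\<lambda>r. T (t - r) (U s (A x)))"
          by (rule continuous_on_compose2[OF T_continuous]) (auto intro!: continuous_intros)
        then show "((\<lambda>r. T (t - r) (U s (A x))) \<longlongrightarrow> T (t - s) (U s (A x))) (at s within {0..t})"
          using s by (simp add: continuous_on_def)
      qed
      then show ?thesis using Us by simp
    qed
    then obtain c where "\<And>s. s \<in> {0..t} \<Longrightarrow> g s = c"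
      using has_vector_derivative_zero_constant[of "{0..t}" g] by auto
    then have "g 0 = g t" using t by simp
    then show ?thesis by (simp add: g_def)
  qed
  have "T t = U t" if "0 \<le> t" for t
  proof (rule blinfun_eqI)
    fix x
    have "closed {x. T t x = U t x}"
      by (intro closed_Collect_eq continuous_intros)
    then have "closure D \<subseteq> {x. T t x = U t x}"
      using eq that by (intro closure_minimal) auto
    then show "T t x = U t x" using closure_D by auto
  qed
  then show ?thesis
    using T_extensional U.T_extensional by (intro extensionalityI) auto
qed

text \<open>The preimage is the Laplace transform of the orbit, a limit of orbit integrals along the
  integers whose increments are dominated by a geometric series. Positivity is part of the statement
  because it is read off from this integral.\<close>

lemma resolvent_surj:
  assumes "0 < l"
  shows "\<exists>y\<in>D. l *\<^sub>R y - A y = x \<and> (0 \<le> x \<longrightarrow> 0 \<le> y)"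
proof -
  let ?F = "orbit_integral l x"
  let ?C = "decomposition_constant TYPE('a) * norm x"
  have "summable (\<lambda>n. ?F (real (Suc n)) - ?F (real n))"
  proof (rule summable_comparison_test'[where N = 0])
    show "summable (\<lambda>n. exp (- l) ^ n * ?C)"
      using assms by (intro summable_mult2 summable_geometric) auto
    show "norm (?F (real (Suc n)) - ?F (real n)) \<le> exp (- l) ^ n * ?C" for n
      using orbit_integral_diff_norm[of l n "Suc n" x] assms
      by (simp add: mult.commute[of l] flip: exp_of_nat_mult)
  qed
  then obtain y where "(\<lambda>n. ?F (real (Suc n)) - ?F (real n)) sums y" by (auto simp: summable_def)
  then have y: "(\<lambda>n. ?F (real n)) \<longlonglongrightarrow> y"
    unfolding sums_def by (subst (asm) sum_lessThan_telescope) (simp add: orbit_integral_def)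
  \<comment> \<open>The summand 0 matches the function \<open>g\<close> of
    \<open>orbit_integral_generator_aux\<close>: over an infinite interval the shift changes only
    the lower end.\<close>
  have Ty: "T h y = exp (l * h) *\<^sub>R (y + 0 - ?F h)" if h: "0 \<le> h" for h
  proof -
    have "(\<lambda>n. ?F (real n + h) - ?F (real n)) \<longlonglongrightarrow> 0"
    proof (rule Lim_null_comparison)
      show "eventually (\<lambda>n. norm (?F (real n + h) - ?F (real n)) \<le> exp (- l) ^ n * (?C * h)) sequentially"
      proof (intro always_eventually allI)
        show "norm (?F (real n + h) - ?F (real n)) \<le> exp (- l) ^ n * (?C * h)" for n
          using orbit_integral_diff_norm[of l n "n + h" x] assms h
          by (simp add: mult_ac flip: exp_of_nat_mult)
      qed
      show "(\<lambda>n. exp (- l) ^ n * (?C * h)) \<longlonglongrightarrow> 0"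
        using assms by (intro tendsto_mult_left_zero LIMSEQ_realpow_zero) auto
    qed
    from tendsto_add[OF this y] have "(\<lambda>n. ?F (real n + h)) \<longlonglongrightarrow> y" by simp
    then have "(\<lambda>n. exp (l * h) *\<^sub>R (?F (real n + h) - ?F h)) \<longlonglongrightarrow> exp (l * h) *\<^sub>R (y - ?F h)"
      by (intro tendsto_intros)
    moreover have "(\<lambda>n. T h (?F (real n))) \<longlonglongrightarrow> T h y" by (intro tendsto_intros y)
    ultimately show ?thesis using T_orbit_integral[OF h, of "real _" l x] LIMSEQ_unique by simp
  qed
  have "y \<in> D" "A y = l *\<^sub>R y + 0 - x"
    using orbit_integral_generator_aux[of "\<lambda>_. 0" 0 y l x] Ty by auto
  moreover have "0 \<le> y" if "0 \<le> x"
  proof (rule nonneg_tendsto[OF y])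
    show "eventually (\<lambda>n. 0 \<le> ?F (real n)) sequentially"
      using T_nonneg that unfolding orbit_integral_def
      by (intro always_eventually allI has_integral_nonneg_cone[OF integrable_integral[OF orbit_integrable]])
        (auto intro: scaleR_nonneg_nonneg)
  qed simp
  ultimately show ?thesis by (intro bexI[of _ y]) auto
qed

text \<open>For an eigenvector \<open>y\<close> the function
  \<open>exp (- l * t) *\<^sub>R T t y\<close> is constant by its derivative, and tends to 0 because
  \<open>T\<close> is uniformly bounded.\<close>

lemma resolvent_inj:
  assumes "0 < l" "y \<in> D" "A y = l *\<^sub>R y"
  shows "y = 0"
proof -
  have der: "((\<lambda>t. exp (- l * t) *\<^sub>R T t y) has_vector_derivative 0) (at t within {0..})" if "t \<in> {0..}" for t
    using that assms(3)
    by (auto intro!: derivative_eq_intros T_has_vector_derivative[OF assms(2)] simp: blinfun.scaleR_right)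
  obtain c where c: "\<And>t. t \<in> {0..} \<Longrightarrow> exp (- l * t) *\<^sub>R T t y = c"
    using has_vector_derivative_zero_constant[OF convex_real_interval(1) der] by metis
  then have const: "y = exp (- l * t) *\<^sub>R T t y" if "0 \<le> t" for t
    using c[of 0] c[of t] that by simp
  have bound: "norm y \<le> exp (- l) ^ n * (decomposition_constant TYPE('a) * norm y)" for n :: nat
  proof -
    have "norm y = exp (- l * n) * norm (T n y)"
      using const[of n]
      by (metis abs_exp_cancel norm_scaleR of_nat_0_le_iff)
    also have "\<dots> \<le> exp (- l * n) * (decomposition_constant TYPE('a) * norm y)"
      by (intro mult_left_mono T_norm) auto
    finally show ?thesis by (simp add: mult.commute[of l] flip: exp_of_nat_mult)
  qed
  have "(\<lambda>n. exp (- l) ^ n * (decomposition_constant TYPE('a) * norm y)) \<longlonglongrightarrow> 0"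
    using assms by (intro tendsto_mult_left_zero LIMSEQ_realpow_zero) auto
  then have "norm y \<le> 0" using bound by (intro LIMSEQ_le_const) auto
  then show ?thesis by simp
qed

lemma inj_on_resolvent: "0 < l \<Longrightarrow> inj_on (\<lambda>x. l *\<^sub>R x - A x) D"
proof (rule inj_onI)
  fix x y assume "0 < l" "x \<in> D" "y \<in> D" "l *\<^sub>R x - A x = l *\<^sub>R y - A y"
  then have "x - y = 0"
    using subspace_D by (intro resolvent_inj[of l]) (auto simp: A_diff subspace_diff algebra_simps)
  then show "x = y" by simp
qed

abbreviation R :: "real \<Rightarrow> 'a \<Rightarrow> 'a" where "R \<equiv> resolvent D A"

context
  fixes l :: real assumes l: "0 < l"
begin

lemma R_in_D: "R l x \<in> D" and R_right_inverse: "l *\<^sub>R R l x - A (R l x) = x"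
proof -
  have "x \<in> (\<lambda>x. l *\<^sub>R x - A x) ` D" using resolvent_surj[OF l, of x] by force
  then show "R l x \<in> D" "l *\<^sub>R R l x - A (R l x) = x"
    unfolding resolvent_def by (rule inv_into_into, rule f_inv_into_f[where f = "\<lambda>x. l *\<^sub>R x - A x"])
qed

lemma A_R: "A (R l x) = l *\<^sub>R R l x - x"
  using R_right_inverse[of x] by (simp add: algebra_simps)

lemma R_eqI: "y \<in> D \<Longrightarrow> l *\<^sub>R y - A y = x \<Longrightarrow> R l x = y"
  unfolding resolvent_def using inj_on_resolvent[OF l] by (auto intro: inv_into_f_eq)

lemma R_left_inverse: "y \<in> D \<Longrightarrow> R l (l *\<^sub>R y - A y) = y"
  by (rule R_eqI) auto

lemma R_nonneg: "0 \<le> x \<Longrightarrow> 0 \<le> R l x"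
  using resolvent_surj[OF l, of x] R_eqI by metis

lemma linear_R: "linear (R l)"
proof
  show "R l (x + y) = R l x + R l y" for x y
    using subspace_D R_in_D by (intro R_eqI) (simp_all add: A_add A_R subspace_add algebra_simps)
  show "R l (c *\<^sub>R x) = c *\<^sub>R R l x" for x c
    using subspace_D R_in_D by (intro R_eqI) (simp_all add: A_scaleR A_R subspace_scale algebra_simps)
qed

end

text \<open>On the cone \<open>Psi\<close> is the norm, so \<open>Psi\<close> of the difference
  quotient is \<open>(norm (T h u) - norm u) / h\<close>, which is at most 0.\<close>

lemma Psi_generator_le:
  assumes "u \<in> D" "0 \<le> u"
  shows "blinfun_apply Psi (A u) \<le> 0"
proof (rule tendsto_upperbound)
  show "((\<lambda>h. blinfun_apply Psi ((T h u - u) /\<^sub>R h)) \<longlongrightarrow> blinfun_apply Psi (A u)) (at_right 0)"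
    by (intro tendsto_intros generator_tendsto assms)
  show "eventually (\<lambda>h. blinfun_apply Psi ((T h u - u) /\<^sub>R h) \<le> 0) (at_right 0)"
    unfolding eventually_at_right_field
    using assms by (intro exI[of _ 1])
      (auto simp: blinfun.bilinear_simps Psi_nonneg T_nonneg T_norm_nonneg mult_le_0_iff)
qed simp

lemma R_norm_nonneg:
  assumes "0 < l" "0 \<le> u"
  shows "l * norm (R l u) \<le> norm u"
proof -
  have "l * norm (R l u) - norm u = blinfun_apply Psi (A (R l u))"
    using assms by (simp add: A_R blinfun.bilinear_simps Psi_nonneg R_nonneg)
  then show ?thesis using Psi_generator_le[OF R_in_D[OF assms(1)] R_nonneg[OF assms]] by linarith
qed

end

lemma substochastic_generationI:
  "substochastic_semigroup T \<Longrightarrow> substochastic_generation (generator_domain T) (generator T) T"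
  by (simp add: substochastic_generation_def generates_def substochastic_semigroup_def)

section \<open>Generation by Yosida approximation\<close>

lemma norm_diff_le_of_vector_derivative:
  fixes f :: "real \<Rightarrow> 'a::real_normed_vector"
  assumes "0 \<le> t"
    and der: "\<And>s. s \<in> {0..t} \<Longrightarrow> (f has_vector_derivative f' s) (at s within {0..t})"
    and bnd: "\<And>s. s \<in> {0..t} \<Longrightarrow> norm (f' s) \<le> B"
  shows "norm (f t - f 0) \<le> B * t"
proof -
  have "norm (f t - f 0) \<le> B * norm (t - 0)"
  proof (rule differentiable_bound[where S = "{0..t}" and f' = "\<lambda>s h. h *\<^sub>R f' s"])
    show "onorm (\<lambda>h. h *\<^sub>R f' s) \<le> B" if "s \<in> {0..t}" for s
      using bnd[OF that] by (intro onorm_le) (simp add: mult.commute[of B] mult_left_mono)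
  qed (use assms in \<open>auto simp: has_vector_derivative_def\<close>)
  then show ?thesis using assms(1) by simp
qed

text \<open>Takes a sequence of vectors instead of an operator. Applied to an orbit
  \<open>J^n x\<close>, it can use a bound on the orbit that is uniform in \<open>n\<close>, whereas
  powers of the operator norm might grow; differentiation becomes a shift of the sequence.\<close>

definition exp_series :: "(nat \<Rightarrow> 'a::banach) \<Rightarrow> real \<Rightarrow> 'a" where
  "exp_series a s = (\<Sum>n. (s ^ n / fact n) *\<^sub>R a n)"

lemma exp_series_bound_sums: "(\<lambda>n. \<bar>s\<bar> ^ n / fact n * C) sums (exp \<bar>s\<bar> * (C::real))"
  using sums_mult2[OF exp_converges[of "\<bar>s\<bar>"], of C] by (simp add: divide_inverse mult_ac)

context
  fixes a :: "nat \<Rightarrow> 'a::banach" and C :: real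
  assumes C: "\<And>n. norm (a n) \<le> C"
begin

lemma exp_series_term_norm: "norm ((s ^ n / fact n) *\<^sub>R a n) \<le> \<bar>s\<bar> ^ n / fact n * C"
  using mult_left_mono[OF C[of n], of "\<bar>s\<bar> ^ n / fact n"] by (simp add: power_abs)

lemma exp_series_summable_norm: "summable (\<lambda>n. norm ((s ^ n / fact n) *\<^sub>R a n))"
  by (rule summable_comparison_test'[OF sums_summable[OF exp_series_bound_sums], where N = 0])
    (unfold real_norm_def abs_norm_cancel, rule exp_series_term_norm)

lemma exp_series_sums: "(\<lambda>n. (s ^ n / fact n) *\<^sub>R a n) sums exp_series a s"
  unfolding exp_series_def by (rule summable_sums[OF summable_norm_cancel[OF exp_series_summable_norm]])

lemma exp_series_norm: "norm (exp_series a s) \<le> exp \<bar>s\<bar> * C"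
proof -
  have "norm (exp_series a s) \<le> (\<Sum>n. norm ((s ^ n / fact n) *\<^sub>R a n))"
    unfolding exp_series_def by (rule summable_norm[OF exp_series_summable_norm])
  also have "\<dots> \<le> (\<Sum>n. \<bar>s\<bar> ^ n / fact n * C)"
    by (intro suminf_le exp_series_term_norm exp_series_summable_norm
        sums_summable[OF exp_series_bound_sums])
  finally show ?thesis using sums_unique[OF exp_series_bound_sums] by simp
qed

lemma exp_series_has_vector_derivative:
  "(exp_series a has_vector_derivative exp_series (\<lambda>n. a (Suc n)) s) (at s)"
proof -
  define r where "r = \<bar>s\<bar> + 1"
  define S where "S = {-r<..<r}"
  define f where "f n x = (x ^ n / fact n) *\<^sub>R a n" for n x
  define f' where "f' n x = (case n of 0 \<Rightarrow> 0 | Suc m \<Rightarrow> (x ^ m / fact m) *\<^sub>R a n)" for n x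
  let ?g' = "exp_series (\<lambda>n. a (Suc n))"
  have s: "s \<in> S" by (auto simp: S_def r_def)
  have lim: "uniform_limit S (\<lambda>n x. \<Sum>i<n. (x ^ i / fact i) *\<^sub>R a (Suc i))
      (\<lambda>x. \<Sum>i. (x ^ i / fact i) *\<^sub>R a (Suc i)) sequentially"
  proof (rule Weierstrass_m_test)
    show "summable (\<lambda>i. \<bar>r\<bar> ^ i / fact i * C)" by (rule sums_summable[OF exp_series_bound_sums])
    have C0: "0 \<le> C" using C[of 0] norm_ge_zero order_trans by blast
    fix n x assume "x \<in> S"
    then have "\<bar>x\<bar> \<le> \<bar>r\<bar>" by (auto simp: S_def)
    then have "\<bar>x\<bar> ^ n / fact n * norm (a (Suc n)) \<le> \<bar>r\<bar> ^ n / fact n * C"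
      using C[of "Suc n"] C0 by (intro mult_mono divide_right_mono power_mono) auto
    then show "norm ((x ^ n / fact n) *\<^sub>R a (Suc n)) \<le> \<bar>r\<bar> ^ n / fact n * C"
      by (simp add: power_abs)
  qed
  have "\<exists>g. \<forall>x\<in>S. (\<lambda>n. f n x) sums g x \<and> (g has_derivative (\<lambda>h. h *\<^sub>R ?g' x)) (at x within S)"
  proof (rule has_derivative_series[OF _ _ _ s])
    show "convex S" by (simp add: S_def)
    show "(f n has_derivative (\<lambda>h. h *\<^sub>R f' n x)) (at x within S)" for n x
    proof (cases n)
      case 0
      then show ?thesis by (simp add: f_def[abs_def] f'_def)
    next
      case (Suc m)
      have "real (Suc m) * x ^ m / fact (Suc m) = x ^ m / fact m"
        unfolding fact_Suc by (rule mult_divide_mult_cancel_left) simp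
      then have "((\<lambda>x. x ^ n / fact n) has_real_derivative x ^ m / fact m) (at x within S)"
        using DERIV_cdivide[OF DERIV_pow[of "Suc m" x S], of "fact (Suc m)"] by (simp add: Suc)
      from has_vector_derivative_scaleR[OF this has_vector_derivative_const[of "a n"]]
      show ?thesis by (simp add: f_def[abs_def] f'_def Suc has_vector_derivative_def)
    qed
    show "(\<lambda>n. f n s) sums exp_series a s" unfolding f_def by (rule exp_series_sums)
    fix e :: real assume e: "e > 0"
    have "eventually (\<lambda>n. \<forall>x\<in>S. dist (\<Sum>i<n. (x ^ i / fact i) *\<^sub>R a (Suc i)) (?g' x) < e) sequentially"
      using lim e unfolding uniform_limit_iff exp_series_def by blast
    \<comment> \<open>The term of index 0 is constant, so the first \<open>n\<close> terms
      differentiate to \<open>n - 1\<close> terms of the shifted series.\<close>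
    then have "eventually (\<lambda>n. \<forall>x\<in>S. dist (\<Sum>i<n-1. (x ^ i / fact i) *\<^sub>R a (Suc i)) (?g' x) < e) sequentially"
      by (rule eventually_compose_filterlim) (rule filterlim_minus_const_nat_at_top)
    with eventually_gt_at_top[of 0]
    show "eventually (\<lambda>n. \<forall>x\<in>S. \<forall>h. norm ((\<Sum>i<n. h *\<^sub>R f' i x) - h *\<^sub>R ?g' x) \<le> e * norm h) sequentially"
    proof eventually_elim
      case (elim n)
      then obtain m where m: "n = Suc m" using gr0_implies_Suc by blast
      show ?case
      proof (intro ballI allI)
        fix x h assume x: "x \<in> S"
        have "(\<Sum>i<n. f' i x) = (\<Sum>i<n-1. (x ^ i / fact i) *\<^sub>R a (Suc i))"
          unfolding m by (subst sum.lessThan_Suc_shift) (simp add: f'_def)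
        then have "(\<Sum>i<n. h *\<^sub>R f' i x) - h *\<^sub>R ?g' x =
            h *\<^sub>R ((\<Sum>i<n-1. (x ^ i / fact i) *\<^sub>R a (Suc i)) - ?g' x)"
          by (simp add: scaleR_diff_right flip: scaleR_sum_right)
        moreover have "norm ((\<Sum>i<n-1. (x ^ i / fact i) *\<^sub>R a (Suc i)) - ?g' x) \<le> e"
          using elim(2) x by (auto simp: dist_norm intro: less_imp_le)
        ultimately show "norm ((\<Sum>i<n. h *\<^sub>R f' i x) - h *\<^sub>R ?g' x) \<le> e * norm h"
          by (simp add: mult.commute[of e] mult_left_mono)
      qed
    qed
  qed
  then obtain g where g: "\<And>x. x \<in> S \<Longrightarrow> (\<lambda>n. f n x) sums g x"
    "\<And>x. x \<in> S \<Longrightarrow> (g has_derivative (\<lambda>h. h *\<^sub>R ?g' x)) (at x within S)" by blast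
  have eq: "exp_series a x = g x" if "x \<in> S" for x
    using sums_unique2[OF exp_series_sums g(1)[OF that, unfolded f_def]] .
  have "(exp_series a has_derivative (\<lambda>h. h *\<^sub>R ?g' s)) (at s within S)"
    using s eq g(2)[OF s] by (rule has_derivative_transform)
  then show ?thesis
    using s at_within_open[of s S] by (simp add: has_vector_derivative_def S_def)
qed

end

text \<open>This is the exponential of \<open>t l (J - 1)\<close>, written as the average of the
  powers of \<open>J\<close> with Poisson weights of mean \<open>l t\<close>. For nonnegative
  \<open>l\<close> and \<open>t\<close> the weights are nonnegative with sum 1, so the average
  inherits substochasticity from the powers.\<close>

definition poisson_semigroup :: "('a::banach \<Rightarrow>\<^sub>L 'a) \<Rightarrow> real \<Rightarrow> real \<Rightarrow> 'a \<Rightarrow>\<^sub>L 'a" where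
  "poisson_semigroup J l t =
     Blinfun (\<lambda>x. exp (- (l * t)) *\<^sub>R exp_series (\<lambda>n. (blinfun_apply J ^^ n) x) (l * t))"

locale substochastic_operator =
  fixes J :: "'a::abstract_state_space \<Rightarrow>\<^sub>L 'a"
  assumes J: "substochastic J"
begin

lemma linear_power: "linear (blinfun_apply J ^^ n)"
proof (induction n)
  case 0 show ?case by (simp add: linear_id id_def[symmetric])
next
  case (Suc n)
  then show ?case
    using linear_compose[OF Suc bounded_linear.linear[OF blinfun.bounded_linear_right[of J]]]
    by (simp add: o_def)
qed

lemma power_substochastic:
  assumes "0 \<le> u"
  shows "0 \<le> (blinfun_apply J ^^ n) u" "norm ((blinfun_apply J ^^ n) u) \<le> norm u"
  using J assms
  by (induction n) (auto simp: substochastic_def intro: order_trans)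

text \<open>Powers are bounded on the cone first; the decomposition is applied once, so its constant
  is not raised to the power \<open>n\<close>.\<close>

lemma power_norm: "norm ((blinfun_apply J ^^ n) x) \<le> decomposition_constant TYPE('a) * norm x"
  using norm_le_of_nonneg_bound[OF linear_power, of 1] power_substochastic by simp

lemma power_sums:
  "(\<lambda>n. (s ^ n / fact n) *\<^sub>R (blinfun_apply J ^^ n) x) sums exp_series (\<lambda>n. (blinfun_apply J ^^ n) x) s"
  by (rule exp_series_sums) (rule power_norm)

lemma poisson_apply:
  "poisson_semigroup J l t x = exp (- (l * t)) *\<^sub>R exp_series (\<lambda>n. (blinfun_apply J ^^ n) x) (l * t)"
proof -
  let ?e = "\<lambda>x. exp_series (\<lambda>n. (blinfun_apply J ^^ n) x) (l * t)"
  have "bounded_linear (\<lambda>x. exp (- (l * t)) *\<^sub>R ?e x)"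
  proof (intro bounded_linear_scaleR_right[THEN bounded_linear_compose] bounded_linear_intro)
    show "?e (x + y) = ?e x + ?e y" for x y
    proof (rule sums_unique2[OF power_sums])
      show "(\<lambda>n. ((l * t) ^ n / fact n) *\<^sub>R (blinfun_apply J ^^ n) (x + y)) sums (?e x + ?e y)"
        using sums_add[OF power_sums power_sums, of "l * t" x "l * t" y]
        by (simp add: linear_add[OF linear_power] scaleR_add_right)
    qed
    show "?e (c *\<^sub>R x) = c *\<^sub>R ?e x" for c x
    proof (rule sums_unique2[OF power_sums])
      show "(\<lambda>n. ((l * t) ^ n / fact n) *\<^sub>R (blinfun_apply J ^^ n) (c *\<^sub>R x)) sums (c *\<^sub>R ?e x)"
        using sums_scaleR_right[OF power_sums, of c "l * t" x]
        by (simp add: linear_scale[OF linear_power] mult.commute)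
    qed
    show "norm (?e x) \<le> norm x * (exp \<bar>l * t\<bar> * decomposition_constant TYPE('a))" for x
      using exp_series_norm[of "\<lambda>n. (blinfun_apply J ^^ n) x", OF power_norm, of "l * t"] by (simp add: mult_ac)
  qed
  then show ?thesis unfolding poisson_semigroup_def by (simp add: bounded_linear_Blinfun_apply)
qed

lemma poisson_sums:
  "(\<lambda>n. (exp (- (l * t)) * ((l * t) ^ n / fact n)) *\<^sub>R (blinfun_apply J ^^ n) x) sums
     poisson_semigroup J l t x"
  unfolding poisson_apply
  using sums_scaleR_right[OF power_sums, of "exp (- (l * t))"] by simp

lemma poisson_0: "poisson_semigroup J l 0 = id_blinfun"
proof (rule blinfun_eqI)
  fix x
  have "(\<lambda>n. (0 ^ n / fact n) *\<^sub>R (blinfun_apply J ^^ n) x) sums x"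
    using sums_finite[of "{0}" "\<lambda>n. (0 ^ n / fact n) *\<^sub>R (blinfun_apply J ^^ n) x"] by simp
  then show "poisson_semigroup J l 0 x = id_blinfun x"
    using sums_unique2[OF power_sums[of 0 x]] by (simp add: poisson_apply)
qed

lemma poisson_substochastic:
  assumes "0 \<le> l" "0 \<le> t"
  shows "substochastic (poisson_semigroup J l t)"
  unfolding substochastic_def
proof (intro conjI allI impI)
  fix u :: 'a assume u: "0 \<le> u"
  show "0 \<le> poisson_semigroup J l t u"
    using assms power_substochastic(1)[OF u]
    by (intro nonneg_suminf[OF poisson_sums]) (auto intro!: scaleR_nonneg_nonneg)
  have "norm (poisson_semigroup J l t u) \<le> exp (- (l * t)) * (exp \<bar>l * t\<bar> * norm u)"
    using exp_series_norm[of "\<lambda>n. (blinfun_apply J ^^ n) u" "norm u" "l * t"] power_substochastic(2)[OF u]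
    by (simp add: poisson_apply)
  also have "\<dots> = norm u" using assms by (simp flip: exp_add mult.assoc)
  finally show "norm (poisson_semigroup J l t u) \<le> norm u" .
qed

lemma poisson_norm:
  "0 \<le> l \<Longrightarrow> 0 \<le> t \<Longrightarrow> norm (poisson_semigroup J l t x) \<le> decomposition_constant TYPE('a) * norm x"
  by (intro substochastic_norm_le poisson_substochastic)

lemma poisson_commute:
  fixes C :: "'a \<Rightarrow>\<^sub>L 'a"
  assumes "\<And>x. C (J x) = J (C x)"
  shows "C (poisson_semigroup J l t x) = poisson_semigroup J l t (C x)"
proof -
  have C: "C ((blinfun_apply J ^^ n) x) = (blinfun_apply J ^^ n) (C x)" for n
    using assms by (induction n) auto
  have "(\<lambda>n. C ((exp (- (l * t)) * ((l * t) ^ n / fact n)) *\<^sub>R (blinfun_apply J ^^ n) x)) sums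
      C (poisson_semigroup J l t x)"
    by (rule bounded_linear.sums[OF blinfun.bounded_linear_right poisson_sums])
  then show ?thesis
    using sums_unique2[OF poisson_sums[of l t "C x"]] by (simp add: blinfun.scaleR_right C)
qed

lemma poisson_has_vector_derivative:
  "((\<lambda>t. poisson_semigroup J l t x) has_vector_derivative
     poisson_semigroup J l t (l *\<^sub>R (J x - x))) (at t within S)"
proof -
  let ?a = "\<lambda>n. (blinfun_apply J ^^ n) x"
  let ?e = "exp_series (\<lambda>n. (blinfun_apply J ^^ n) x)"
  let ?e' = "exp_series (\<lambda>n. (blinfun_apply J ^^ n) (J x))"
  have shift: "(\<lambda>n. ?a (Suc n)) = (\<lambda>n. (blinfun_apply J ^^ n) (J x))"
    by (simp add: funpow_swap1)
  have "(?e has_vector_derivative ?e' (l * t)) (at (l * t) within (\<lambda>t. l * t) ` S)"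
    using exp_series_has_vector_derivative[of ?a, OF power_norm] unfolding shift
    by (rule has_vector_derivative_at_within)
  moreover have "((\<lambda>t. l * t) has_vector_derivative l) (at t within S)"
    by (auto intro!: derivative_eq_intros)
  ultimately have "((\<lambda>t. ?e (l * t)) has_vector_derivative l *\<^sub>R ?e' (l * t)) (at t within S)"
    using vector_diff_chain_within[of "\<lambda>t. l * t" l t S ?e] by (simp add: o_def)
  moreover have "((\<lambda>t. exp (- (l * t))) has_real_derivative - (l * exp (- (l * t)))) (at t within S)"
    by (auto intro!: derivative_eq_intros)
  ultimately have "((\<lambda>t. exp (- (l * t)) *\<^sub>R ?e (l * t)) has_vector_derivative
      (exp (- (l * t)) *\<^sub>R l *\<^sub>R ?e' (l * t) + (- (l * exp (- (l * t)))) *\<^sub>R ?e (l * t))) (at t within S)"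
    by (rule has_vector_derivative_scaleR[rotated])
  moreover have "exp (- (l * t)) *\<^sub>R l *\<^sub>R ?e' (l * t) + (- (l * exp (- (l * t)))) *\<^sub>R ?e (l * t) =
      poisson_semigroup J l t (l *\<^sub>R (J x - x))"
    by (simp add: blinfun.scaleR_right blinfun.diff_right poisson_apply[symmetric] scaleR_diff_right)
      (simp add: poisson_apply mult.commute)
  ultimately show ?thesis by (simp add: poisson_apply)
qed

end

text \<open>Interpolates between two commuting Poisson semigroups; the derivative carries the
  difference of the two bounded generators. With equal semigroups it vanishes, and the offset
  \<open>r\<close> then gives the semigroup law. With \<open>r = 0\<close> it gives the comparison
  of two Yosida approximants, where each semigroup contributes one factor of the decomposition
  constant.\<close>

lemma poisson_compare_derivative:
  assumes J: "substochastic J" and J': "substochastic J'" and l: "0 \<le> l" "0 \<le> l'"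
    and comm: "\<And>x. blinfun_apply J (J' x) = J' (J x)"
    and s: "s \<in> {0..t}" and r: "0 \<le> r"
  shows "((\<lambda>s. poisson_semigroup J' l' (t - s) (poisson_semigroup J l (r + s) x)) has_vector_derivative
    poisson_semigroup J' l' (t - s) (poisson_semigroup J l (r + s) (l *\<^sub>R (J x - x) - l' *\<^sub>R (J' x - x))))
    (at s within {0..t})"
proof -
  interpret J: substochastic_operator J by (standard; fact)
  interpret J': substochastic_operator J' by (standard; fact)
  let ?P = "poisson_semigroup J l" and ?P' = "poisson_semigroup J' l'"
  have chain: "((\<lambda>s. f (c s)) has_vector_derivative c' *\<^sub>R f') (at s within {0..t})"
    if "\<And>S. (f has_vector_derivative f') (at (c s) within S)" "(c has_vector_derivative c') (at s within {0..t})"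
    for f :: "real \<Rightarrow> 'a" and c f' c'
    using vector_diff_chain_within[OF that(2) that(1)] by (simp add: o_def)
  have "((\<lambda>s. ?P' (t - s) (?P (r + s) x)) has_vector_derivative
      (- ?P' (t - s) (l' *\<^sub>R (J' (?P (r + s) x) - ?P (r + s) x)) + ?P' (t - s) (?P (r + s) (l *\<^sub>R (J x - x)))))
      (at s within {0..t})"
  proof (rule has_vector_derivative_blinfun_family)
    show "((\<lambda>s. ?P (r + s) x) has_vector_derivative ?P (r + s) (l *\<^sub>R (J x - x))) (at s within {0..t})"
      using chain[OF J.poisson_has_vector_derivative, of "\<lambda>s. r + s" 1 l x]
        has_vector_derivative_add[OF has_vector_derivative_const has_vector_derivative_id, of r]
      by simp
    show "((\<lambda>q. ?P' (t - q) z) has_vector_derivative - ?P' (t - s) (l' *\<^sub>R (J' z - z))) (at s within {0..t})" for z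
      using chain[OF J'.poisson_has_vector_derivative, of "\<lambda>s. t - s" "-1" l' z]
        has_vector_derivative_diff[OF has_vector_derivative_const has_vector_derivative_id, of t]
      by simp
    then show "((\<lambda>q. ?P' (t - q) z) \<longlongrightarrow> ?P' (t - s) z) (at s within {0..t})" for z
      using has_vector_derivative_continuous continuous_within by blast
    show "norm (?P' (t - q) z) \<le> decomposition_constant TYPE('a) * norm z" if "q \<in> {0..t}" for q z
      using that l by (intro J'.poisson_norm) auto
  qed
  moreover have "J' (?P (r + s) x) = ?P (r + s) (J' x)"
    using comm by (intro J.poisson_commute) simp
  ultimately show ?thesis
    by (simp add: blinfun.bilinear_simps algebra_simps)
qed

lemma poisson_add:
  assumes J: "substochastic J" and l: "0 \<le> l" and "0 \<le> r" "0 \<le> t"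
  shows "poisson_semigroup J l (r + t) x = poisson_semigroup J l t (poisson_semigroup J l r x)"
proof -
  let ?g = "\<lambda>s. poisson_semigroup J l (t - s) (poisson_semigroup J l (r + s) x)"
  have "norm (?g t - ?g 0) \<le> 0 * t"
    using assms poisson_compare_derivative[OF J J l l, of _ t r x]
    by (intro norm_diff_le_of_vector_derivative[where f' = "\<lambda>_. 0"]) (auto simp: blinfun.zero_right)
  then show ?thesis
    using substochastic_operator.poisson_0[OF substochastic_operator.intro[OF J]] by simp
qed

lemma poisson_compare:
  fixes J :: "'a::abstract_state_space \<Rightarrow>\<^sub>L 'a"
  assumes J: "substochastic J" and J': "substochastic J'" and l: "0 \<le> l" "0 \<le> l'"
    and comm: "\<And>x. blinfun_apply J (J' x) = J' (J x)" and t: "0 \<le> t"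
  shows "norm (poisson_semigroup J l t x - poisson_semigroup J' l' t x) \<le>
    decomposition_constant TYPE('a) ^ 2 * norm (l *\<^sub>R (J x - x) - l' *\<^sub>R (J' x - x)) * t"
proof -
  interpret J: substochastic_operator J by (standard; fact)
  interpret J': substochastic_operator J' by (standard; fact)
  let ?K = "decomposition_constant TYPE('a)"
  let ?z = "l *\<^sub>R (J x - x) - l' *\<^sub>R (J' x - x)"
  let ?g = "\<lambda>s. poisson_semigroup J' l' (t - s) (poisson_semigroup J l s x)"
  have "norm (?g t - ?g 0) \<le> ?K ^ 2 * norm ?z * t"
  proof (rule norm_diff_le_of_vector_derivative[OF t])
    fix s assume s: "s \<in> {0..t}"
    show "(?g has_vector_derivative poisson_semigroup J' l' (t - s) (poisson_semigroup J l s ?z))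
        (at s within {0..t})"
      using poisson_compare_derivative[OF J J' l comm s order_refl] by simp
    have "norm (poisson_semigroup J' l' (t - s) (poisson_semigroup J l s ?z)) \<le>
        ?K * norm (poisson_semigroup J l s ?z)" using s l by (intro J'.poisson_norm) auto
    also have "\<dots> \<le> ?K * (?K * norm ?z)"
      using s l decomposition_constant_pos[where 'a = 'a]
      by (intro mult_left_mono J.poisson_norm) (auto intro: less_imp_le)
    finally show "norm (poisson_semigroup J' l' (t - s) (poisson_semigroup J l s ?z)) \<le> ?K ^ 2 * norm ?z"
      by (simp add: power2_eq_square mult.assoc)
  qed
  then show ?thesis by (simp add: J.poisson_0 J'.poisson_0)
qed

section \<open>The Hille-Yosida theorem for substochastic resolvents\<close>

lemma tendsto_of_dense:
  fixes S :: "nat \<Rightarrow> 'a::real_normed_vector \<Rightarrow>\<^sub>L 'b::real_normed_vector" and L :: "'a \<Rightarrow>\<^sub>L 'b"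
  assumes bnd: "\<And>n x. norm (S n x) \<le> K * norm x" and L: "\<And>x. norm (L x) \<le> K * norm x"
    and dense: "closure D = UNIV" and lim: "\<And>x. x \<in> D \<Longrightarrow> (\<lambda>n. S n x) \<longlonglongrightarrow> blinfun_apply L x"
  shows "(\<lambda>n. S n x) \<longlonglongrightarrow> blinfun_apply L x"
proof (rule LIMSEQ_I)
  fix e :: real assume e: "e > 0"
  define d where "d = e / (4 * (\<bar>K\<bar> + 1))"
  have d: "d > 0" using e by (simp add: d_def)
  then obtain y where y: "y \<in> D" "dist y x < d"
    using dense closure_approachable[of x D] by auto
  have K: "K * norm (x - y) \<le> e / 4"
  proof -
    have "K * norm (x - y) \<le> (\<bar>K\<bar> + 1) * d"
      using y(2) by (intro mult_mono) (auto simp: dist_norm norm_minus_commute)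
    also have "(\<bar>K\<bar> + 1) * d = e / 4"
      using abs_ge_zero[of K] by (simp add: d_def field_simps)
    finally show ?thesis .
  qed
  obtain N where N: "\<And>n. n \<ge> N \<Longrightarrow> norm (S n y - L y) < e / 2"
    using LIMSEQ_D[OF lim[OF y(1)], of "e / 2"] e by auto
  show "\<exists>N. \<forall>n\<ge>N. norm (S n x - L x) < e"
  proof (intro exI allI impI)
    fix n assume n: "n \<ge> N"
    have eq: "S n x - L x = S n (x - y) - L (x - y) + (S n y - L y)"
      by (simp add: blinfun.diff_right)
    have "norm (S n x - L x) \<le> norm (S n (x - y)) + norm (L (x - y)) + norm (S n y - L y)"
      unfolding eq by (intro norm_triangle_le add_right_mono norm_triangle_ineq4)
    also have "\<dots> < e / 4 + e / 4 + e / 2"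
      using bnd[of n "x - y"] L[of "x - y"] K N[OF n] by linarith
    finally show "norm (S n x - L x) < e" by simp
  qed
qed

lemma Cauchy_of_dense:
  fixes S :: "nat \<Rightarrow> 'a::real_normed_vector \<Rightarrow>\<^sub>L 'b::real_normed_vector"
  assumes bnd: "\<And>n x. norm (S n x) \<le> K * norm x"
    and dense: "closure D = UNIV" and cauchy: "\<And>x. x \<in> D \<Longrightarrow> Cauchy (\<lambda>n. blinfun_apply (S n) x)"
  shows "Cauchy (\<lambda>n. blinfun_apply (S n) x)"
proof (rule CauchyI)
  fix e :: real assume e: "e > 0"
  define d where "d = e / (4 * (\<bar>K\<bar> + 1))"
  have d: "d > 0" using e by (simp add: d_def)
  then obtain y where y: "y \<in> D" "dist y x < d"
    using dense closure_approachable[of x D] by auto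
  have K: "K * norm (x - y) \<le> e / 4"
  proof -
    have "K * norm (x - y) \<le> (\<bar>K\<bar> + 1) * d"
      using y(2) by (intro mult_mono) (auto simp: dist_norm norm_minus_commute)
    also have "(\<bar>K\<bar> + 1) * d = e / 4"
      using abs_ge_zero[of K] by (simp add: d_def field_simps)
    finally show ?thesis .
  qed
  obtain N where N: "\<And>m n. m \<ge> N \<Longrightarrow> n \<ge> N \<Longrightarrow> norm (S m y - S n y) < e / 2"
    using CauchyD[OF cauchy[OF y(1)], of "e / 2"] e by auto
  show "\<exists>N. \<forall>m\<ge>N. \<forall>n\<ge>N. norm (S m x - S n x) < e"
  proof (intro exI allI impI)
    fix m n assume mn: "m \<ge> N" "n \<ge> N"
    have eq: "S m x - S n x = S m (x - y) - S n (x - y) + (S m y - S n y)"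
      by (simp add: blinfun.diff_right)
    have "norm (S m x - S n x) \<le> norm (S m (x - y)) + norm (S n (x - y)) + norm (S m y - S n y)"
      unfolding eq by (intro norm_triangle_le add_right_mono norm_triangle_ineq4)
    also have "\<dots> < e / 4 + e / 4 + e / 2"
      using bnd[of m "x - y"] bnd[of n "x - y"] K N[OF mn] by linarith
    finally show "norm (S m x - S n x) < e" by simp
  qed
qed

text \<open>The Hille-Yosida conditions in their form on the cone. The resolvent is a parameter of
  its own because the application supplies it by an explicit formula.\<close>

locale substochastic_resolvents =
  fixes D :: "'a::abstract_state_space set" and H :: "'a \<Rightarrow> 'a" and R :: "real \<Rightarrow> 'a \<Rightarrow> 'a"
  assumes linear_H: "linear_operator D H"
    and dense_D: "closure D = UNIV"
    and R_in_D: "0 < l \<Longrightarrow> R l x \<in> D"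
    and R_right: "0 < l \<Longrightarrow> l *\<^sub>R R l x - H (R l x) = x"
    and R_left: "0 < l \<Longrightarrow> y \<in> D \<Longrightarrow> R l (l *\<^sub>R y - H y) = y"
    and R_nonneg: "0 < l \<Longrightarrow> 0 \<le> x \<Longrightarrow> 0 \<le> R l x"
    and R_norm_nonneg: "0 < l \<Longrightarrow> 0 \<le> x \<Longrightarrow> l * norm (R l x) \<le> norm x"
begin

lemma subspace_D: "subspace D"
  and H_add: "x \<in> D \<Longrightarrow> y \<in> D \<Longrightarrow> H (x + y) = H x + H y"
  and H_scaleR: "x \<in> D \<Longrightarrow> H (c *\<^sub>R x) = c *\<^sub>R H x"
  using linear_H by (auto simp: linear_operator_def)

lemma H_R: "0 < l \<Longrightarrow> H (R l x) = l *\<^sub>R R l x - x"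
  using R_right[of l x] by (simp add: algebra_simps)

lemma linear_R:
  assumes l: "0 < l"
  shows "linear (R l)"
proof
  fix x y c
  have "l *\<^sub>R (R l x + R l y) - H (R l x + R l y) = x + y"
    using l R_in_D by (simp add: H_add H_R algebra_simps)
  then show "R l (x + y) = R l x + R l y"
    using R_left[OF l, of "R l x + R l y"] R_in_D[OF l] subspace_D by (simp add: subspace_add)
  have "l *\<^sub>R (c *\<^sub>R R l x) - H (c *\<^sub>R R l x) = c *\<^sub>R x"
    using l R_in_D by (simp add: H_scaleR H_R algebra_simps)
  then show "R l (c *\<^sub>R x) = c *\<^sub>R R l x"
    using R_left[OF l, of "c *\<^sub>R R l x"] R_in_D[OF l] subspace_D by (simp add: subspace_scale)
qed

text \<open>The resolvent identity read in both orders, with the factor \<open>l - m\<close>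
  cancelled. Commutation is what makes the interpolation between two Yosida approximants
  work.\<close>

lemma R_commute:
  assumes l: "0 < l" and m: "0 < m"
  shows "R l (R m x) = R m (R l x)"
proof (cases "l = m")
  case False
  have *: "R l x + (l - m) *\<^sub>R R l (R m x) = R m x" if "0 < l" "0 < m" for l m
    using R_left[OF that(1) R_in_D[OF that(2), of x]] that
    by (simp add: H_R algebra_simps linear_add[OF linear_R] linear_diff[OF linear_R] linear_scale[OF linear_R])
  have "(l - m) *\<^sub>R R l (R m x) = R m x - R l x" "(m - l) *\<^sub>R R m (R l x) = R l x - R m x"
    using *[OF l m] *[OF m l] by (simp_all only: eq_diff_eq add.commute)
  then have "(l - m) *\<^sub>R R l (R m x) = - ((m - l) *\<^sub>R R m (R l x))" by simp
  also have "\<dots> = (l - m) *\<^sub>R R m (R l x)" by (simp flip: scaleR_minus_left)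
  finally show ?thesis using False by simp
qed simp

definition J :: "real \<Rightarrow> 'a \<Rightarrow>\<^sub>L 'a" where "J l = Blinfun (\<lambda>x. l *\<^sub>R R l x)"

lemma J_apply:
  assumes l: "0 < l"
  shows "J l x = l *\<^sub>R R l x"
proof -
  have lin: "linear (\<lambda>x. l *\<^sub>R R l x)"
    using linear_compose_scale_right[OF linear_R[OF l]] .
  have "norm (l *\<^sub>R R l x) \<le> decomposition_constant TYPE('a) * 1 * norm x" for x
    by (rule norm_le_of_nonneg_bound[OF lin]) (use l R_norm_nonneg in auto)
  then have "bounded_linear (\<lambda>x. l *\<^sub>R R l x)"
    using linear_add[OF lin] linear_scale[OF lin]
    by (intro bounded_linear_intro[where K = "decomposition_constant TYPE('a)"]) (simp_all only: mult.commute mult_1)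
  then show ?thesis unfolding J_def by (simp add: bounded_linear_Blinfun_apply)
qed

lemma J_substochastic: "0 < l \<Longrightarrow> substochastic (J l)"
  unfolding substochastic_def using R_nonneg R_norm_nonneg
  by (auto simp: J_apply intro!: scaleR_nonneg_nonneg)

lemma yosida:
  assumes l: "0 < l" and x: "x \<in> D"
  shows "l *\<^sub>R (J l x - x) = J l (H x)" "norm (J l x - x) \<le> decomposition_constant TYPE('a) * norm (H x) / l"
proof -
  have "l *\<^sub>R R l x - x = R l (H x)"
    using R_left[OF l x] by (simp add: linear_diff[OF linear_R[OF l]] linear_scale[OF linear_R[OF l]] algebra_simps)
  then show eq: "l *\<^sub>R (J l x - x) = J l (H x)" using l by (simp add: J_apply)
  have "l * norm (J l x - x) = norm (J l (H x))" using l by (simp flip: eq)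
  also have "\<dots> \<le> decomposition_constant TYPE('a) * norm (H x)"
    by (rule substochastic_norm_le[OF J_substochastic[OF l]])
  finally show "norm (J l x - x) \<le> decomposition_constant TYPE('a) * norm (H x) / l"
    using l by (simp add: field_simps)
qed

lemma J_tendsto: "(\<lambda>n. J (real (Suc n)) x) \<longlonglongrightarrow> x"
proof -
  have "(\<lambda>n. J (real (Suc n)) x) \<longlonglongrightarrow> id_blinfun x"
  proof (rule tendsto_of_dense[OF _ _ dense_D])
    \<comment> \<open>The summand 1 makes this a common bound for the operators \<open>J\<close> and
      for the identity, their limit.\<close>
    show "norm (J (real (Suc n)) x) \<le> (decomposition_constant TYPE('a) + 1) * norm x" for n x
      using substochastic_norm_le[OF J_substochastic[of "real (Suc n)"], of x]
      by (simp add: distrib_right add_increasing2)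
    show "norm (id_blinfun x) \<le> (decomposition_constant TYPE('a) + 1) * norm x" for x :: 'a
      using decomposition_constant_pos[where 'a = 'a] by (simp add: distrib_right)
    fix x assume x: "x \<in> D"
    have "(\<lambda>n. J (real (Suc n)) x - x) \<longlonglongrightarrow> 0"
    proof (rule Lim_null_comparison)
      show "eventually (\<lambda>n. norm (J (real (Suc n)) x - x) \<le>
          decomposition_constant TYPE('a) * norm (H x) * inverse (real (Suc n))) sequentially"
        using yosida(2)[OF _ x] by (intro always_eventually allI) (simp add: divide_inverse del: of_nat_Suc)
      show "(\<lambda>n. decomposition_constant TYPE('a) * norm (H x) * inverse (real (Suc n))) \<longlonglongrightarrow> 0"
        by (intro tendsto_mult_right_zero LIMSEQ_inverse_real_of_nat)
    qed
    then show "(\<lambda>n. J (real (Suc n)) x) \<longlonglongrightarrow> id_blinfun x" by (simp add: LIM_zero_iff del: of_nat_Suc)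
  qed
  then show ?thesis by simp
qed

text \<open>The semigroup of the Yosida approximant \<open>l (J l - 1)\<close> at
  \<open>l = n + 1\<close>, a choice that keeps \<open>l\<close> positive for every
  \<open>n\<close>.\<close>

definition S :: "nat \<Rightarrow> real \<Rightarrow> 'a \<Rightarrow>\<^sub>L 'a" where
  "S n t = poisson_semigroup (J (real (Suc n))) (real (Suc n)) t"

lemma S_substochastic: "0 \<le> t \<Longrightarrow> substochastic (S n t)"
  unfolding S_def
  by (intro substochastic_operator.poisson_substochastic substochastic_operator.intro J_substochastic) auto

lemma S_norm: "0 \<le> t \<Longrightarrow> norm (S n t x) \<le> decomposition_constant TYPE('a) * norm x"
  by (intro substochastic_norm_le S_substochastic)

lemma S_0: "S n 0 = id_blinfun"
  unfolding S_def
  by (intro substochastic_operator.poisson_0 substochastic_operator.intro J_substochastic) auto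

lemma S_add: "0 \<le> s \<Longrightarrow> 0 \<le> t \<Longrightarrow> S n (s + t) x = S n s (S n t x)"
  unfolding S_def using poisson_add[OF J_substochastic[of "real (Suc n)"], of "real (Suc n)" t s x]
  by (simp add: add.commute[of s])

lemma S_has_vector_derivative:
  "x \<in> D \<Longrightarrow> ((\<lambda>t. S n t x) has_vector_derivative S n t (J (real (Suc n)) (H x))) (at t within Q)"
  unfolding S_def
  using substochastic_operator.poisson_has_vector_derivative[OF
      substochastic_operator.intro[OF J_substochastic], of "real (Suc n)" "real (Suc n)" x t Q]
  by (simp add: yosida(1) del: of_nat_Suc)

lemma S_diff_norm:
  assumes "x \<in> D" "0 \<le> t"
  shows "norm (S m t x - S n t x) \<le> decomposition_constant TYPE('a) ^ 2 *
    norm (J (real (Suc m)) (H x) - J (real (Suc n)) (H x)) * t"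
proof -
  have "J (real (Suc m)) (J (real (Suc n)) z) = J (real (Suc n)) (J (real (Suc m)) z)" for z
    by (simp add: J_apply linear_scale[OF linear_R] R_commute[of "real (Suc m)"] del: of_nat_Suc)
  then show ?thesis
    unfolding S_def
    using poisson_compare[OF J_substochastic J_substochastic, of "real (Suc m)" "real (Suc n)"
        "real (Suc m)" "real (Suc n)" t x] assms
    by (simp add: yosida(1) del: of_nat_Suc)
qed

lemma S_Cauchy:
  assumes t: "0 \<le> t"
  shows "Cauchy (\<lambda>n. blinfun_apply (S n t) x)"
proof (rule Cauchy_of_dense[OF S_norm[OF t] dense_D])
  fix x assume x: "x \<in> D"
  \<comment> \<open>The summand 1 keeps the divisor positive at \<open>t = 0\<close>.\<close>
  define c where "c = decomposition_constant TYPE('a) ^ 2 * t + 1"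
  have c: "c > 0" using t by (simp add: c_def add_nonneg_pos)
  show "Cauchy (\<lambda>n. blinfun_apply (S n t) x)"
  proof (rule CauchyI)
    fix e :: real assume e: "e > 0"
    obtain N where N: "\<And>m n. m \<ge> N \<Longrightarrow> n \<ge> N \<Longrightarrow>
        norm (J (real (Suc m)) (H x) - J (real (Suc n)) (H x)) < e / c"
      using CauchyD[OF LIMSEQ_imp_Cauchy[OF J_tendsto], of "e / c" "H x"] e c by auto
    show "\<exists>N. \<forall>m\<ge>N. \<forall>n\<ge>N. norm (S m t x - S n t x) < e"
    proof (intro exI allI impI)
      fix m n assume mn: "m \<ge> N" "n \<ge> N"
      have "norm (S m t x - S n t x) \<le> c * norm (J (real (Suc m)) (H x) - J (real (Suc n)) (H x))"
        using add_mono[OF S_diff_norm[OF x t, of m n] norm_ge_zero[of "J (real (Suc m)) (H x) - J (real (Suc n)) (H x)"]]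
        by (simp add: c_def algebra_simps)
      also have "\<dots> < c * (e / c)" using N[OF mn] c by (rule mult_strict_left_mono)
      finally show "norm (S m t x - S n t x) < e" using c by simp
    qed
  qed
qed

definition W :: "real \<Rightarrow> 'a \<Rightarrow>\<^sub>L 'a" where
  "W = (\<lambda>t\<in>{0..}. Blinfun (\<lambda>x. lim (\<lambda>n. S n t x)))"

lemma S_tendsto_W:
  assumes t: "0 \<le> t"
  shows "(\<lambda>n. S n t x) \<longlonglongrightarrow> W t x"
proof -
  let ?L = "\<lambda>x. lim (\<lambda>n. S n t x)"
  have lim: "(\<lambda>n. S n t x) \<longlonglongrightarrow> ?L x" for x
    using S_Cauchy[OF t] by (intro convergent_LIMSEQ_iff[THEN iffD1] Cauchy_convergent)
  have "bounded_linear ?L"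
  proof (rule bounded_linear_intro)
    show "?L (x + y) = ?L x + ?L y" for x y
      using tendsto_add[OF lim[of x] lim[of y]] by (intro LIMSEQ_unique[OF lim]) (simp add: blinfun.add_right)
    show "?L (c *\<^sub>R x) = c *\<^sub>R ?L x" for c x
      using tendsto_scaleR[OF tendsto_const lim[of x], of c]
      by (intro LIMSEQ_unique[OF lim]) (simp add: blinfun.scaleR_right)
    show "norm (?L x) \<le> norm x * decomposition_constant TYPE('a)" for x
      using S_norm[OF t] by (intro LIMSEQ_le_const2[OF tendsto_norm[OF lim]]) (auto simp: mult.commute)
  qed
  then show ?thesis using lim t by (simp add: W_def bounded_linear_Blinfun_apply)
qed

lemma W_substochastic:
  assumes t: "0 \<le> t"
  shows "substochastic (W t)"
  unfolding substochastic_def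
proof (intro conjI allI impI)
  fix u :: 'a assume u: "0 \<le> u"
  show "0 \<le> W t u"
    using S_substochastic[OF t] u
    by (intro nonneg_tendsto[OF S_tendsto_W[OF t]]) (auto simp: substochastic_def)
  show "norm (W t u) \<le> norm u"
    using S_substochastic[OF t] u
    by (intro LIMSEQ_le_const2[OF tendsto_norm[OF S_tendsto_W[OF t]]]) (auto simp: substochastic_def)
qed

lemma W_add:
  assumes s: "0 \<le> s" and t: "0 \<le> t"
  shows "W (s + t) = W s o\<^sub>L W t"
proof (rule blinfun_eqI)
  fix x
  \<comment> \<open>The inner vector moves with \<open>n\<close>; the bound on \<open>S n s\<close>,
    uniform in \<open>n\<close>, reduces the composition to strong convergence at the fixed vector
    \<open>W t x\<close>.\<close>
  have "(\<lambda>n. S n s (S n t x - W t x)) \<longlonglongrightarrow> 0"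
  proof (rule Lim_null_comparison)
    show "eventually (\<lambda>n. norm (S n s (S n t x - W t x)) \<le>
        decomposition_constant TYPE('a) * norm (S n t x - W t x)) sequentially"
      using S_norm[OF s] by simp
    have "(\<lambda>n. S n t x - W t x) \<longlonglongrightarrow> 0"
      using S_tendsto_W[OF t] by (rule LIM_zero)
    then show "(\<lambda>n. decomposition_constant TYPE('a) * norm (S n t x - W t x)) \<longlonglongrightarrow> 0"
      by (intro tendsto_mult_right_zero tendsto_norm_zero)
  qed
  from tendsto_add[OF this S_tendsto_W[OF s, of "W t x"]]
  have "(\<lambda>n. S n (s + t) x) \<longlonglongrightarrow> W s (W t x)"
    using S_add[OF s t] by (simp add: blinfun.diff_right)
  then show "W (s + t) x = (W s o\<^sub>L W t) x"
    using LIMSEQ_unique[OF S_tendsto_W[of "s + t" x]] s t by simp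
qed

lemma S_diff_id_norm:
  assumes x: "x \<in> D" and t: "0 \<le> t"
  shows "norm (S n t x - x) \<le> decomposition_constant TYPE('a) ^ 2 * norm (H x) * t"
proof -
  let ?K = "decomposition_constant TYPE('a)"
  have K: "0 \<le> ?K" using decomposition_constant_pos[where 'a = 'a] by simp
  have "norm (S n t x - S n 0 x) \<le> ?K ^ 2 * norm (H x) * t"
  proof (rule norm_diff_le_of_vector_derivative[OF t S_has_vector_derivative[OF x]])
    fix s assume s: "s \<in> {0..t}"
    have "norm (S n s (J (real (Suc n)) (H x))) \<le> ?K * norm (J (real (Suc n)) (H x))"
      using s by (intro S_norm) auto
    also have "\<dots> \<le> ?K * (?K * norm (H x))"
      using K by (intro mult_left_mono substochastic_norm_le J_substochastic) auto
    finally show "norm (S n s (J (real (Suc n)) (H x))) \<le> ?K ^ 2 * norm (H x)"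
      by (simp add: power2_eq_square mult.assoc)
  qed
  then show ?thesis by (simp add: S_0)
qed

text \<open>\<open>H x\<close> need not lie in \<open>D\<close>, so the orbit of \<open>H x\<close>
  has no rate of convergence at 0. A nearby \<open>y\<close> in \<open>D\<close> has a Lipschitz
  orbit; the price is a multiple of \<open>norm (H x - y)\<close>, which density makes small. The
  bound is proved for the approximants, where the error of \<open>J\<close> at \<open>H x\<close>
  disappears in the limit.\<close>

lemma W_diff_estimate:
  assumes x: "x \<in> D" and y: "y \<in> D" and t: "0 \<le> t"
  shows "norm (W t x - x - t *\<^sub>R H x) \<le> t * ((decomposition_constant TYPE('a) + 1) * norm (H x - y) +
    decomposition_constant TYPE('a) ^ 2 * norm (H y) * t)"
proof -
  let ?K = "decomposition_constant TYPE('a)"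
  let ?B = "(?K + 1) * norm (H x - y) + ?K ^ 2 * norm (H y) * t"
  have bound: "norm (S n t x - x - t *\<^sub>R H x) \<le>
      (?K * norm (J (real (Suc n)) (H x) - H x) + ?B) * t" for n
  proof -
    have "norm ((S n t x - t *\<^sub>R H x) - (S n 0 x - 0 *\<^sub>R H x)) \<le>
        (?K * norm (J (real (Suc n)) (H x) - H x) + ?B) * t"
    proof (rule norm_diff_le_of_vector_derivative[OF t])
      fix s assume s: "s \<in> {0..t}"
      show "((\<lambda>s. S n s x - s *\<^sub>R H x) has_vector_derivative
          S n s (J (real (Suc n)) (H x)) - H x) (at s within {0..t})"
        by (auto intro!: derivative_eq_intros S_has_vector_derivative[OF x])
      have eq: "S n s (J (real (Suc n)) (H x)) - H x = S n s (J (real (Suc n)) (H x) - H x) +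
          (S n s (H x - y) + ((S n s y - y) + (y - H x)))"
        by (simp add: blinfun.diff_right)
      have "norm (S n s (J (real (Suc n)) (H x)) - H x) \<le> ?K * norm (J (real (Suc n)) (H x) - H x) +
          (?K * norm (H x - y) + (?K ^ 2 * norm (H y) * s + norm (y - H x)))"
        unfolding eq using s S_diff_id_norm[OF y, of s n]
        by (intro norm_triangle_mono S_norm) auto
      also have "\<dots> \<le> ?K * norm (J (real (Suc n)) (H x) - H x) +
          (?K * norm (H x - y) + (?K ^ 2 * norm (H y) * t + norm (y - H x)))"
        using s by (intro add_mono order_refl mult_left_mono) auto
      finally show "norm (S n s (J (real (Suc n)) (H x)) - H x) \<le>
          ?K * norm (J (real (Suc n)) (H x) - H x) + ?B"
        by (simp add: algebra_simps norm_minus_commute)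
    qed
    then show ?thesis by (simp add: S_0 algebra_simps)
  qed
  have "(\<lambda>n. norm (S n t x - x - t *\<^sub>R H x)) \<longlonglongrightarrow> norm (W t x - x - t *\<^sub>R H x)"
    by (intro tendsto_intros S_tendsto_W t)
  moreover have "(\<lambda>n. (?K * norm (J (real (Suc n)) (H x) - H x) + ?B) * t) \<longlonglongrightarrow> (?K * 0 + ?B) * t"
    by (intro tendsto_intros tendsto_norm_zero LIM_zero J_tendsto)
  ultimately have "norm (W t x - x - t *\<^sub>R H x) \<le> (?K * 0 + ?B) * t"
    using bound by (intro LIMSEQ_le) auto
  then show ?thesis by (simp add: mult.commute)
qed

lemma W_has_vector_derivative:
  assumes x: "x \<in> D"
  shows "((\<lambda>t. W t x) has_vector_derivative H x) (at 0 within {0..})"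
  unfolding has_vector_derivative_within_alt
proof (intro allI impI)
  fix e :: real assume e: "e > 0"
  let ?K = "decomposition_constant TYPE('a)"
  have K: "?K > 0" by (rule decomposition_constant_pos)
  have "e / (2 * (?K + 1)) > 0" using e K by simp
  then obtain y where y: "y \<in> D" "dist y (H x) < e / (2 * (?K + 1))"
    using dense_D closure_approachable[of "H x" D] by auto
  have 1: "(?K + 1) * norm (H x - y) \<le> e / 2"
    using y(2) K by (simp add: dist_norm norm_minus_commute field_simps)
  \<comment> \<open>The summand 1 keeps the divisor positive when \<open>H y = 0\<close>.\<close>
  define c where "c = ?K ^ 2 * norm (H y) + 1"
  have c: "c > 0" by (simp add: c_def add_nonneg_pos)
  have W0: "W 0 x = x" using LIMSEQ_unique[OF S_tendsto_W[of 0 x]] by (simp add: S_0)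
  show "\<exists>d>0. \<forall>t\<in>{0..}. \<bar>t - 0\<bar> < d \<longrightarrow> norm (W t x - W 0 x - (t - 0) *\<^sub>R H x) \<le> e * \<bar>t - 0\<bar>"
  proof (intro exI[of _ "e / (2 * c)"] conjI ballI impI)
    show "e / (2 * c) > 0" using e c by simp
    fix t assume t: "t \<in> {0..}" "\<bar>t - 0\<bar> < e / (2 * c)"
    then have t0: "0 \<le> t" by simp
    have "?K ^ 2 * norm (H y) * t \<le> c * t" using t0 by (intro mult_right_mono) (auto simp: c_def)
    also have "\<dots> \<le> e / 2" using t c by (simp add: field_simps)
    finally have "t * ((?K + 1) * norm (H x - y) + ?K ^ 2 * norm (H y) * t) \<le> t * e"
      using 1 t0 by (intro mult_left_mono) auto
    then show "norm (W t x - W 0 x - (t - 0) *\<^sub>R H x) \<le> e * \<bar>t - 0\<bar>"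
      using W_diff_estimate[OF x y(1) t0] t0 by (simp add: W0 mult.commute)
  qed
qed

lemma W_tendsto_0: "((\<lambda>t. W t x) \<longlongrightarrow> x) (at_right 0)"
  unfolding tendsto_iff
proof (intro allI impI)
  fix e :: real assume e: "e > 0"
  let ?K = "decomposition_constant TYPE('a)"
  have K: "?K > 0" by (rule decomposition_constant_pos)
  have "e / (2 * (?K + 1)) > 0" using e K by simp
  then obtain y where y: "y \<in> D" "dist y x < e / (2 * (?K + 1))"
    using dense_D closure_approachable[of x D] by auto
  have yx: "(?K + 1) * norm (x - y) < e / 2"
    using y(2) K by (simp add: dist_norm norm_minus_commute field_simps)
  have W0: "W 0 y = y" using LIMSEQ_unique[OF S_tendsto_W[of 0 y]] by (simp add: S_0)
  have "((\<lambda>t. W t y) \<longlongrightarrow> y) (at_right 0)"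
    using has_vector_derivative_continuous[OF W_has_vector_derivative[OF y(1)]] W0
    by (simp add: continuous_within at_within_Ici_at_right)
  then have "eventually (\<lambda>t. dist (W t y) y < e / 2) (at_right 0)"
    using e unfolding tendsto_iff by (metis half_gt_zero)
  moreover have "eventually (\<lambda>t::real. 0 < t) (at_right 0)" by (rule eventually_at_right_less)
  ultimately show "eventually (\<lambda>t. dist (W t x) x < e) (at_right 0)"
  proof eventually_elim
    case (elim t)
    have eq: "W t x - x = W t (x - y) + ((W t y - y) + (y - x))" by (simp add: blinfun.diff_right)
    have "norm (W t x - x) \<le> ?K * norm (x - y) + (norm (W t y - y) + norm (y - x))"
      unfolding eq using elim(2)
      by (intro norm_triangle_mono substochastic_norm_le W_substochastic norm_triangle_ineq) auto
    also have "\<dots> = (?K + 1) * norm (x - y) + norm (W t y - y)"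
      by (simp add: algebra_simps norm_minus_commute)
    also have "\<dots> < e" using yx elim(1) by (simp add: dist_norm)
    finally show ?case by (simp add: dist_norm)
  qed
qed

lemma W_substochastic_semigroup: "substochastic_semigroup W"
proof -
  have "W 0 = id_blinfun"
  proof (rule blinfun_eqI)
    fix x
    show "W 0 x = id_blinfun x" using LIMSEQ_unique[OF S_tendsto_W[of 0 x]] by (simp add: S_0)
  qed
  then show ?thesis
    unfolding substochastic_semigroup_def C0_semigroup_def
    using W_add W_tendsto_0 W_substochastic by (auto simp: W_def)
qed

lemma W_operator_extension: "operator_extension (generator_domain W) (generator W) D H"
proof -
  interpret W: substochastic_generation "generator_domain W" "generator W" W
    by (rule substochastic_generationI[OF W_substochastic_semigroup])
  show ?thesis
    unfolding operator_extension_def using W.generatorI_derivative W_has_vector_derivative by blast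
qed

end

section \<open>The defect functional of the Kato semigroup\<close>

locale kato_perturbation =
  A: substochastic_generation DA A S +
  V: substochastic_generation "generator_domain V" "generator V" V
  for DA :: "'a::abstract_state_space set" and A S and V :: "real \<Rightarrow> 'a \<Rightarrow>\<^sub>L 'a" +
  fixes B :: "'a \<Rightarrow> 'a"
  assumes B_add: "x \<in> DA \<Longrightarrow> y \<in> DA \<Longrightarrow> B (x + y) = B x + B y"
    and B_scaleR: "x \<in> DA \<Longrightarrow> B (c *\<^sub>R x) = c *\<^sub>R B x"
    and B_nonneg: "u \<in> DA \<Longrightarrow> 0 \<le> u \<Longrightarrow> 0 \<le> B u"
    and Psi_le: "u \<in> DA \<Longrightarrow> 0 \<le> u \<Longrightarrow> blinfun_apply Psi (A u + B u) \<le> 0"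
    and V_extends: "V \<in> extending_semigroups DA A B"
    and kato_term_sums: "0 < l \<Longrightarrow> kato_term DA A B l u sums V.R l u"
begin

abbreviation DG :: "'a set" where "DG \<equiv> generator_domain V"
abbreviation G :: "'a \<Rightarrow> 'a" where "G \<equiv> generator V"

definition Q :: "real \<Rightarrow> 'a \<Rightarrow> 'a" where "Q l u = B (A.R l u)"

lemma kato_term_eq: "kato_term DA A B l u k = A.R l ((Q l ^^ k) u)"
  by (simp add: kato_term_def Q_def[abs_def])

definition partial_resolvent :: "real \<Rightarrow> 'a \<Rightarrow> nat \<Rightarrow> 'a" where
  "partial_resolvent l u n = (\<Sum>k<n. kato_term DA A B l u k)"

definition \<beta> :: "real \<Rightarrow> 'a \<Rightarrow> real" where
  "\<beta> l u = lim (\<lambda>k. blinfun_apply Psi ((Q l ^^ k) u))"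

text \<open>The functional \<Delta> of the overview, fixed at parameter 1; \<open>defect_eq\<close>
  gives the same value at every positive parameter.\<close>

definition defect :: "'a \<Rightarrow> real" where
  "defect x = \<beta> 1 (x - G x)"

lemma partial_resolvent_tendsto: "0 < l \<Longrightarrow> partial_resolvent l u \<longlonglongrightarrow> V.R l u"
  using kato_term_sums by (simp add: sums_def partial_resolvent_def[abs_def])

context
  fixes l :: real assumes l: "0 < l"
begin

lemma linear_Q: "linear (Q l)"
proof
  show "Q l (x + y) = Q l x + Q l y" for x y
    by (simp add: Q_def linear_add[OF A.linear_R[OF l]] B_add A.R_in_D[OF l])
  show "Q l (c *\<^sub>R x) = c *\<^sub>R Q l x" for c x
    by (simp add: Q_def linear_scale[OF A.linear_R[OF l]] B_scaleR A.R_in_D[OF l])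
qed

lemma linear_Q_power: "linear (Q l ^^ n)"
proof (induction n)
  case 0 show ?case by (simp add: linear_id id_def[symmetric])
next
  case (Suc n)
  then show ?case using linear_compose[OF Suc linear_Q] by (simp add: o_def)
qed

lemma Q_power_nonneg: "0 \<le> u \<Longrightarrow> 0 \<le> (Q l ^^ n) u"
  by (induction n) (auto simp: Q_def intro: B_nonneg A.R_in_D A.R_nonneg l)

text \<open>The mass balance of one step \<open>B R(l, A)\<close>: it loses \<open>l\<close> times
  the mass of the resolvent and the amount \<open>a_fun\<close>. On the cone both losses are
  nonnegative; summed over the powers of \<open>Q l\<close>, the balance telescopes.\<close>

lemma Psi_Q:
  "blinfun_apply Psi (Q l u) = blinfun_apply Psi u - l * blinfun_apply Psi (A.R l u) - a_fun A B (A.R l u)"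
  by (simp add: Q_def a_fun_def A.A_R[OF l] blinfun.bilinear_simps)

lemma norm_Q_le:
  assumes "0 \<le> u" shows "norm (Q l u) \<le> norm u"
proof -
  have "0 \<le> A.R l u" "A.R l u \<in> DA" "0 \<le> Q l u"
    using assms l Q_power_nonneg[of u 1] by (auto intro: A.R_in_D A.R_nonneg)
  then have "norm (Q l u) = norm u - l * norm (A.R l u) - a_fun A B (A.R l u)" "0 \<le> a_fun A B (A.R l u)"
    using Psi_Q[of u] Psi_le[of "A.R l u"] assms by (simp_all add: Psi_nonneg a_fun_def)
  moreover have "0 \<le> l * norm (A.R l u)" using l by simp
  ultimately show ?thesis by linarith
qed

text \<open>On the cone the values are norms and decrease by \<open>norm_Q_le\<close>; a difference
  of positive vectors settles the general case.\<close>

lemma convergent_Psi_Q_power: "convergent (\<lambda>k. blinfun_apply Psi ((Q l ^^ k) x))"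
proof -
  have nonneg: "convergent (\<lambda>k. blinfun_apply Psi ((Q l ^^ k) u))" if u: "0 \<le> u" for u
  proof (rule Bseq_monoseq_convergent[OF decseq_bounded])
    show "decseq (\<lambda>k. blinfun_apply Psi ((Q l ^^ k) u))"
      using Q_power_nonneg[OF u] norm_Q_le Q_power_nonneg[OF u, of "Suc _"]
      by (intro decseq_SucI) (simp add: Psi_nonneg)
    then show "monoseq (\<lambda>k. blinfun_apply Psi ((Q l ^^ k) u))" by (rule decseq_imp_monoseq)
    show "\<forall>k. 0 \<le> blinfun_apply Psi ((Q l ^^ k) u)"
      using Q_power_nonneg[OF u] by (simp add: Psi_nonneg)
  qed
  obtain u v where "0 \<le> u" "0 \<le> v" "x = u - v" using generating_nonneg_cone by blast
  then show ?thesis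
    using convergent_diff[OF nonneg nonneg] by (simp add: linear_diff[OF linear_Q_power] blinfun.diff_right)
qed

lemma \<beta>_tendsto: "(\<lambda>k. blinfun_apply Psi ((Q l ^^ k) x)) \<longlonglongrightarrow> \<beta> l x"
  unfolding \<beta>_def using convergent_Psi_Q_power convergent_LIMSEQ_iff by blast

lemma linear_\<beta>: "linear (\<beta> l)"
proof
  show "\<beta> l (x + y) = \<beta> l x + \<beta> l y" for x y
    using tendsto_add[OF \<beta>_tendsto \<beta>_tendsto, of x y]
    by (intro LIMSEQ_unique[OF \<beta>_tendsto]) (simp add: linear_add[OF linear_Q_power] blinfun.add_right)
  show "\<beta> l (c *\<^sub>R x) = c *\<^sub>R \<beta> l x" for c x
    using tendsto_scaleR[OF tendsto_const \<beta>_tendsto, of c x]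
    by (intro LIMSEQ_unique[OF \<beta>_tendsto]) (simp add: linear_scale[OF linear_Q_power] blinfun.scaleR_right)
qed

lemma \<beta>_nonneg: "0 \<le> u \<Longrightarrow> 0 \<le> \<beta> l u"
  using Q_power_nonneg by (intro LIMSEQ_le_const[OF \<beta>_tendsto]) (simp add: Psi_nonneg)

lemma a_fun_kato_term_sums:
  "(\<lambda>k. a_fun A B (kato_term DA A B l u k)) sums (- blinfun_apply Psi (G (V.R l u)) - \<beta> l u)"
proof -
  have "(\<lambda>k. blinfun_apply Psi ((Q l ^^ k) u) - blinfun_apply Psi ((Q l ^^ Suc k) u)) sums
      (blinfun_apply Psi ((Q l ^^ 0) u) - \<beta> l u)"
    by (rule telescope_sums'[OF \<beta>_tendsto])
  moreover have "(\<lambda>k. l * blinfun_apply Psi (kato_term DA A B l u k)) sums (l * blinfun_apply Psi (V.R l u))"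
    by (intro sums_mult bounded_linear.sums[OF blinfun.bounded_linear_right] kato_term_sums l)
  ultimately have "(\<lambda>k. (blinfun_apply Psi ((Q l ^^ k) u) - blinfun_apply Psi ((Q l ^^ Suc k) u)) -
      l * blinfun_apply Psi (kato_term DA A B l u k)) sums
      ((blinfun_apply Psi ((Q l ^^ 0) u) - \<beta> l u) - l * blinfun_apply Psi (V.R l u))"
    by (rule sums_diff)
  then show ?thesis
    by (simp add: Psi_Q kato_term_eq V.A_R[OF l] blinfun.bilinear_simps algebra_simps)
qed

text \<open>The series of \<open>a_fun\<close> has nonnegative terms on the cone, hence a
  nonnegative sum. In \<open>feedback_semigroup\<close> this says that \<open>G\<close> loses at
  least as much mass as the feedback can return.\<close>

lemma \<beta>_le:
  assumes u: "0 \<le> u"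
  shows "\<beta> l u \<le> - blinfun_apply Psi (G (V.R l u))"
proof -
  have "0 \<le> - blinfun_apply Psi (G (V.R l u)) - \<beta> l u"
    using Psi_le Q_power_nonneg[OF u] l unfolding sums_iff
    by (subst sums_unique[OF a_fun_kato_term_sums], intro suminf_nonneg)
      (auto simp: a_fun_def kato_term_eq intro!: sums_summable[OF a_fun_kato_term_sums[unfolded a_fun_def kato_term_eq]]
        A.R_in_D A.R_nonneg)
  then show ?thesis by simp
qed

lemma \<beta>_le_norm:
  assumes u: "0 \<le> u" shows "\<beta> l u \<le> norm u"
proof -
  have "\<beta> l u \<le> norm u - l * norm (V.R l u)"
    using \<beta>_le[OF u] V.R_nonneg[OF l u] u by (simp add: V.A_R[OF l] blinfun.bilinear_simps Psi_nonneg)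
  moreover have "0 \<le> l * norm (V.R l u)" using l by simp
  ultimately show ?thesis by linarith
qed

lemma bounded_linear_\<beta>: "bounded_linear (\<beta> l)"
proof (rule bounded_linear_intro)
  show "\<beta> l (x + y) = \<beta> l x + \<beta> l y" "\<beta> l (c *\<^sub>R x) = c *\<^sub>R \<beta> l x" for x y c
    using linear_\<beta> by (auto simp: linear_add linear_scale)
  show "norm (\<beta> l x) \<le> norm x * decomposition_constant TYPE('a)" for x
    using norm_le_of_nonneg_bound[OF linear_\<beta>, of 1 x] \<beta>_nonneg \<beta>_le_norm by (simp add: mult.commute)
qed

lemma \<beta>_Q: "\<beta> l (Q l u) = \<beta> l u"
  using LIMSEQ_Suc[OF \<beta>_tendsto[of u]] by (intro LIMSEQ_unique[OF \<beta>_tendsto]) (simp add: funpow_swap1)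

lemma G_eq: "x \<in> DA \<Longrightarrow> G x = A x + B x"
  using V_extends by (auto simp: extending_semigroups_def operator_extension_def)

text \<open>With \<open>y = l x - A x\<close> one has \<open>l x - G x = y - Q l y\<close>, and
  \<beta> does not distinguish \<open>y\<close> from \<open>Q l y\<close>, a shift of its defining
  sequence.\<close>

lemma \<beta>_vanishes: "x \<in> DA \<Longrightarrow> \<beta> l (l *\<^sub>R x - G x) = 0"
  using \<beta>_Q[of "l *\<^sub>R x - A x"]
  by (simp add: G_eq Q_def A.R_left_inverse[OF l] diff_diff_eq[symmetric] linear_diff[OF linear_\<beta>])

text \<open>Each term contributes \<open>Q^k u - Q^(k+1) u\<close>, so the sum telescopes. The
  statement covers an arbitrary extension \<open>H\<close> because it is applied both to
  \<open>G\<close> and to the generator of a competing semigroup.\<close>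

lemma partial_resolvent:
  assumes ext: "operator_extension D' H DA (\<lambda>u. A u + B u)"
  shows "partial_resolvent l u n \<in> DA \<and>
    l *\<^sub>R partial_resolvent l u n - H (partial_resolvent l u n) = u - (Q l ^^ n) u"
proof -
  have H: "H x = A x + B x" if "x \<in> DA" for x using ext that by (simp add: operator_extension_def)
  have "partial_resolvent l u n \<in> DA \<and>
    l *\<^sub>R partial_resolvent l u n - (A (partial_resolvent l u n) + B (partial_resolvent l u n)) = u - (Q l ^^ n) u"
  proof (induction n)
    case 0
    have "0 \<in> DA" using A.subspace_D by (rule subspace_0)
    then show ?case
      using A.A_scaleR[of 0 0] B_scaleR[of 0 0] by (simp add: partial_resolvent_def)
  next
    case (Suc n)
    let ?k = "A.R l ((Q l ^^ n) u)"
    have k: "?k \<in> DA" "A ?k = l *\<^sub>R ?k - (Q l ^^ n) u" "B ?k = (Q l ^^ Suc n) u"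
      by (simp_all add: A.R_in_D[OF l] A.A_R[OF l] Q_def)
    have "partial_resolvent l u (Suc n) = partial_resolvent l u n + ?k"
      by (simp add: partial_resolvent_def kato_term_eq)
    then show ?case
      using Suc k(1) A.subspace_D
      by (simp only: A.A_add B_add subspace_add k(2,3)) (simp add: algebra_simps)
  qed
  then show ?thesis using H by auto
qed

end

section \<open>Independence of the defect from the resolvent parameter\<close>

lemma G_extension: "operator_extension DG G DA (\<lambda>u. A u + B u)"
  using V_extends by (simp add: extending_semigroups_def)

text \<open>The argument on the left is \<open>(m - G) x\<close> for \<open>x = R(l, G) u\<close>.
  Replace \<open>x\<close> by a partial sum, which lies in D(A): there the functional at
  \<open>m\<close> kills the image under \<open>m - G\<close>, and only \<open>\<beta> m\<close> of
  \<open>(Q l ^^ n) u\<close> is left. This is at most the norm of that vector, which tends to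
  \<open>\<beta> l u\<close>.\<close>

lemma \<beta>_resolvent_le:
  assumes l: "0 < l" and m: "0 < m" and u: "0 \<le> u"
  shows "\<beta> m (u + (m - l) *\<^sub>R V.R l u) \<le> \<beta> l u"
proof (rule LIMSEQ_le)
  show "(\<lambda>n. \<beta> m (u + (m - l) *\<^sub>R partial_resolvent l u n)) \<longlonglongrightarrow> \<beta> m (u + (m - l) *\<^sub>R V.R l u)"
    by (intro bounded_linear.tendsto[OF bounded_linear_\<beta>[OF m]] tendsto_intros partial_resolvent_tendsto l)
  show "(\<lambda>n. blinfun_apply Psi ((Q l ^^ n) u)) \<longlonglongrightarrow> \<beta> l u" by (rule \<beta>_tendsto[OF l])
  have "\<beta> m (u + (m - l) *\<^sub>R partial_resolvent l u n) \<le> blinfun_apply Psi ((Q l ^^ n) u)" for n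
  proof -
    let ?s = "partial_resolvent l u n"
    have s: "?s \<in> DA" "l *\<^sub>R ?s - G ?s = u - (Q l ^^ n) u"
      using partial_resolvent[OF l G_extension] by auto
    have "u + (m - l) *\<^sub>R ?s = (m *\<^sub>R ?s - G ?s) + (Q l ^^ n) u"
      using s(2) by (simp add: algebra_simps)
    then have "\<beta> m (u + (m - l) *\<^sub>R ?s) = \<beta> m ((Q l ^^ n) u)"
      using \<beta>_vanishes[OF m s(1)] by (simp add: linear_add[OF linear_\<beta>[OF m]])
    also have "\<dots> \<le> norm ((Q l ^^ n) u)" by (intro \<beta>_le_norm m Q_power_nonneg l u)
    finally show ?thesis using Psi_nonneg[OF Q_power_nonneg[OF l u]] by simp
  qed
  then show "\<exists>N. \<forall>n\<ge>N. \<beta> m (u + (m - l) *\<^sub>R partial_resolvent l u n) \<le> blinfun_apply Psi ((Q l ^^ n) u)"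
    by blast
qed

lemma \<beta>_independent:
  assumes l: "0 < l" and m: "0 < m" and x: "x \<in> DG"
  shows "\<beta> m (m *\<^sub>R x - G x) = \<beta> l (l *\<^sub>R x - G x)"
proof -
  have nonneg: "\<beta> m (u + (m - l) *\<^sub>R V.R l u) = \<beta> l u" if lm: "0 < l" "l \<le> m" and u: "0 \<le> u" for l m u
  proof (rule antisym)
    have m: "0 < m" using lm by simp
    show "\<beta> m (u + (m - l) *\<^sub>R V.R l u) \<le> \<beta> l u" by (rule \<beta>_resolvent_le[OF lm(1) m u])
    \<comment> \<open>The reverse inequality is the same lemma with \<open>l\<close> and
      \<open>m\<close> exchanged, applied to \<open>(m - G) x\<close>. That vector is in the cone
      because \<open>l \<le> m\<close>; the opposite order of parameters follows by
      symmetry.\<close>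
    let ?w = "u + (m - l) *\<^sub>R V.R l u"
    have w: "0 \<le> ?w" using u lm by (intro add_nonneg_nonneg scaleR_nonneg_nonneg V.R_nonneg) auto
    have "V.R m ?w = V.R l u"
      using lm V.R_in_D by (intro V.R_eqI[OF m]) (auto simp: V.A_R algebra_simps)
    then have eq: "?w + (l - m) *\<^sub>R V.R m ?w = u" by (simp add: algebra_simps)
    show "\<beta> l u \<le> \<beta> m ?w" using \<beta>_resolvent_le[OF m lm(1) w] unfolding eq .
  qed
  have le: "\<beta> m (m *\<^sub>R x - G x) = \<beta> l (l *\<^sub>R x - G x)" if lm: "0 < l" "l \<le> m" for l m
  proof -
    have m: "0 < m" using lm by simp
    \<comment> \<open>It is \<open>(l - G) x\<close> that is split, not \<open>x\<close>: the
      positive parts must be arguments of the resolvent.\<close>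
    obtain u v where uv: "0 \<le> u" "0 \<le> v" "l *\<^sub>R x - G x = u - v" using generating_nonneg_cone by blast
    have R: "V.R l u - V.R l v = x"
      using V.R_left_inverse[OF lm(1) x] uv(3) by (simp add: linear_diff[OF V.linear_R[OF lm(1)]])
    have "(u + (m - l) *\<^sub>R V.R l u) - (v + (m - l) *\<^sub>R V.R l v) = (u - v) + (m - l) *\<^sub>R (V.R l u - V.R l v)"
      by (simp add: algebra_simps)
    then have "m *\<^sub>R x - G x = (u + (m - l) *\<^sub>R V.R l u) - (v + (m - l) *\<^sub>R V.R l v)"
      unfolding R uv(3)[symmetric] by (simp add: algebra_simps)
    then show ?thesis
      using nonneg[OF lm uv(1)] nonneg[OF lm uv(2)] uv(3) linear_diff[OF linear_\<beta>] lm(1) m by simp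
  qed
  show ?thesis using le[of l m] le[of m l] l m by (cases "l \<le> m") auto
qed

lemma defect_eq: "0 < l \<Longrightarrow> x \<in> DG \<Longrightarrow> \<beta> l (l *\<^sub>R x - G x) = defect x"
  using \<beta>_independent[of 1 l x] by (simp add: defect_def)

lemma defect_R: "0 < l \<Longrightarrow> defect (V.R l u) = \<beta> l u"
  using defect_eq[of l "V.R l u"] V.R_in_D[of l u] V.R_right_inverse[of l u] by simp

lemma defect_diff: "x \<in> DG \<Longrightarrow> y \<in> DG \<Longrightarrow> defect (x - y) = defect x - defect y"
  using linear_diff[OF linear_\<beta>[of 1], of "x - G x" "y - G y"]
  by (simp add: defect_def V.A_diff algebra_simps)

section \<open>Honesty as vanishing of the defect\<close>

lemma a_bar_eq:
  assumes x: "x \<in> DG"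
  shows "a_bar DA A B V x = - blinfun_apply Psi (G x) - defect x"
  unfolding a_bar_def
proof (rule the_equality)
  show "\<forall>\<mu>>0. \<forall>u. x = V.R \<mu> u \<longrightarrow>
      (\<lambda>k. a_fun A B (kato_term DA A B \<mu> u k)) sums (- blinfun_apply Psi (G x) - defect x)"
    using a_fun_kato_term_sums by (auto simp: defect_R)
  fix r assume "\<forall>\<mu>>0. \<forall>u. x = V.R \<mu> u \<longrightarrow> (\<lambda>k. a_fun A B (kato_term DA A B \<mu> u k)) sums r"
  \<comment> \<open>Every element of D(G) is a resolvent value, so the condition under
    \<open>THE\<close> is not vacuous and pins down the sum.\<close>
  moreover have "x = V.R 1 (x - G x)" using V.R_left_inverse[of 1 x] x by simp
  ultimately have "(\<lambda>k. a_fun A B (kato_term DA A B 1 (x - G x) k)) sums r" by simp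
  from sums_unique2[OF this a_fun_kato_term_sums]
  show "r = - blinfun_apply Psi (G x) - defect x"
    using \<open>x = V.R 1 (x - G x)\<close> by (simp add: defect_def)
qed

text \<open>\<open>G\<close> maps the integral of the orbit to \<open>V t u - u\<close>, and
  \<open>Psi\<close> of this is the left-hand side of the honesty equation; what remains of
  \<open>a_bar\<close> is the defect.\<close>

lemma honest_iff_integral:
  "honest DA A B V \<longleftrightarrow> (\<forall>t\<ge>0. \<forall>u\<ge>0. defect (integral {0..t} (\<lambda>s. V s u)) = 0)"
proof -
  have "(norm (V t u) - norm u = - a_bar DA A B V (integral {0..t} (\<lambda>s. V s u))) \<longleftrightarrow>
      defect (integral {0..t} (\<lambda>s. V s u)) = 0" if "0 \<le> t" "0 \<le> u" for t u
    using that V.integral_generator[OF that(1), of u]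
    by (simp add: a_bar_eq blinfun.diff_right Psi_nonneg V.T_nonneg)
  then show ?thesis unfolding honest_def by auto
qed

text \<open>For \<open>x\<close> in D(G) the integral means of its orbit converge to
  \<open>x\<close> in the graph norm, and \<open>\<beta> 1\<close> is bounded, so vanishing on
  integrals spreads to D(G). Linearity and the generating cone first remove the restriction to
  positive \<open>u\<close>.\<close>

lemma honest_iff: "honest DA A B V \<longleftrightarrow> (\<forall>x\<in>DG. defect x = 0)"
proof
  assume "honest DA A B V"
  then have nonneg: "defect (integral {0..t} (\<lambda>s. V s u)) = 0" if "0 \<le> t" "0 \<le> u" for t u
    using that by (simp add: honest_iff_integral)
  have int: "defect (integral {0..t} (\<lambda>s. V s x)) = 0" if t: "0 \<le> t" for t x
  proof -
    obtain u v where uv: "0 \<le> u" "0 \<le> v" "x = u - v" using generating_nonneg_cone by blast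
    have i: "(\<lambda>s. V s y) integrable_on {0..t}" for y using V.orbit_integrable[of 0 0 y t] by simp
    have "integral {0..t} (\<lambda>s. V s x) = integral {0..t} (\<lambda>s. V s u) - integral {0..t} (\<lambda>s. V s v)"
      unfolding uv(3) using integral_diff[OF i i, of u v] by (simp add: blinfun.diff_right)
    then show ?thesis using nonneg t uv V.integral_generator(1)[OF t] by (simp add: defect_diff)
  qed
  show "\<forall>x\<in>DG. defect x = 0"
  proof
    fix x assume x: "x \<in> DG"
    let ?I = "\<lambda>t. integral {0..t} (\<lambda>s. V s x)"
    have "((\<lambda>t. \<beta> 1 (?I t /\<^sub>R t - (V t x - x) /\<^sub>R t)) \<longlongrightarrow> \<beta> 1 (x - G x)) (at_right 0)"
      by (intro bounded_linear.tendsto[OF bounded_linear_\<beta>] tendsto_diff V.integral_mean_tendsto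
          V.generator_tendsto x) simp
    moreover have "eventually (\<lambda>t. \<beta> 1 (?I t /\<^sub>R t - (V t x - x) /\<^sub>R t) = 0) (at_right 0)"
    proof (rule eventually_mono[OF eventually_at_right_less[of 0]])
      fix t :: real assume t: "0 < t"
      have "\<beta> 1 (?I t - (V t x - x)) = 0"
        using int[of t x] t V.integral_generator(2)[of t x] by (simp add: defect_def)
      then show "\<beta> 1 (?I t /\<^sub>R t - (V t x - x) /\<^sub>R t) = 0"
        using linear_scale[OF linear_\<beta>[of 1], of "inverse t" "?I t - (V t x - x)"]
        by (simp add: scaleR_diff_right)
    qed
    ultimately have "((\<lambda>t. 0) \<longlongrightarrow> \<beta> 1 (x - G x)) (at_right (0::real))"
      using tendsto_cong by fast
    then show "defect x = 0"
      unfolding defect_def using tendsto_unique[OF _ _ tendsto_const] trivial_limit_at_right_real by blast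
  qed
next
  assume "\<forall>x\<in>DG. defect x = 0"
  then show "honest DA A B V"
    unfolding honest_iff_integral using V.integral_generator(1) by blast
qed

section \<open>Uniqueness in the honest case and rank-one feedback in the dishonest case\<close>

lemma unique_if_honest:
  assumes "honest DA A B V" and W: "W \<in> extending_semigroups DA A B"
  shows "W = V"
proof -
  interpret W: substochastic_generation "generator_domain W" "generator W" W
    using W by (intro substochastic_generationI) (simp add: extending_semigroups_def)
  have ext: "operator_extension (generator_domain W) (generator W) DA (\<lambda>u. A u + B u)"
    using W by (simp add: extending_semigroups_def)
  have \<beta>: "\<beta> 1 u = 0" for u
    using assms(1) defect_R[of 1 u] V.R_in_D[of 1 u] by (simp add: honest_iff)
  have nonneg: "W.R 1 u = V.R 1 u" if u: "0 \<le> u" for u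
  proof -
    \<comment> \<open>On the cone \<open>Psi\<close> measures the full norm, so vanishing of \<beta>
      is norm convergence of the remainder to 0, and the resolvent of \<open>W\<close> is bounded
      there by 1.\<close>
    have "(\<lambda>n. W.R 1 ((Q 1 ^^ n) u)) \<longlonglongrightarrow> 0"
    proof (rule Lim_null_comparison)
      show "eventually (\<lambda>n. norm (W.R 1 ((Q 1 ^^ n) u)) \<le> blinfun_apply Psi ((Q 1 ^^ n) u)) sequentially"
        using W.R_norm_nonneg[of 1] Q_power_nonneg[OF _ u, of 1] by (simp add: Psi_nonneg)
      show "(\<lambda>n. blinfun_apply Psi ((Q 1 ^^ n) u)) \<longlonglongrightarrow> 0"
        using \<beta>_tendsto[of 1 u] by (simp add: \<beta>)
    qed
    from tendsto_diff[OF tendsto_const[of "W.R 1 u"] this]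
    have "(\<lambda>n. W.R 1 (u - (Q 1 ^^ n) u)) \<longlonglongrightarrow> W.R 1 u"
      by (simp add: linear_diff[OF W.linear_R])
    \<comment> \<open>The partial sums lie in D(A), where the generator of \<open>W\<close> agrees
      with \<open>A + B\<close>; hence they do not depend on the choice of \<open>W\<close>.\<close>
    moreover have "W.R 1 (u - (Q 1 ^^ n) u) = partial_resolvent 1 u n" for n
      using partial_resolvent[OF _ ext, of 1 u n] ext
      by (intro W.R_eqI) (auto simp: operator_extension_def)
    ultimately show ?thesis
      using partial_resolvent_tendsto[of 1 u] LIMSEQ_unique by simp
  qed
  have R: "W.R 1 x = V.R 1 x" for x
  proof -
    obtain u v where "0 \<le> u" "0 \<le> v" "x = u - v" using generating_nonneg_cone by blast
    then show ?thesis using nonneg by (simp add: linear_diff[OF W.linear_R] linear_diff[OF V.linear_R])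
  qed
  \<comment> \<open>Equal resolvents at the single parameter 1 already have equal ranges and
    inverses, so the generators coincide.\<close>
  have WV: "x \<in> DG \<and> generator W x = G x" if "x \<in> generator_domain W" for x
  proof -
    have x: "x = V.R 1 (x - generator W x)" using W.R_left_inverse[of 1 x] that R by simp
    then have "x \<in> DG" using V.R_in_D[of 1 "x - generator W x"] by simp
    moreover have "G x = x - (x - generator W x)"
      using V.A_R[of 1 "x - generator W x"] x by simp
    ultimately show ?thesis by simp
  qed
  have VW: "x \<in> generator_domain W" if "x \<in> DG" for x
    using V.R_left_inverse[of 1 x] W.R_in_D[of 1 "x - G x"] that R by simp
  have "substochastic_generation DG G W"
  proof
    show "substochastic_semigroup W" by (rule W.substochastic_semigroup)
    show "generates DG G W"
      unfolding generates_def using W.substochastic_semigroup WV VW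
      by (auto simp: substochastic_semigroup_def)
  qed
  then show ?thesis by (rule V.semigroup_eqI[symmetric])
qed

text \<open>The mass lost by \<open>V\<close> is measured by \<open>defect\<close>; feeding it back along the direction \<open>f\<close>
  is a rank-one perturbation of \<open>G\<close>, whose resolvent is explicit.\<close>

lemma feedback_semigroup:
  assumes f: "0 \<le> f" "norm f < 1"
  shows "\<exists>W\<in>extending_semigroups DA A B. \<forall>x\<in>DG. generator W x = G x + defect x *\<^sub>R f"
proof -
  \<comment> \<open>The equation \<open>(l - H) y = u\<close> reads
    \<open>(l - G) y = u + d f\<close> with \<open>d = defect y\<close>. Applying \<beta> gives
    \<open>d = \<beta> l u + d * \<beta> l f\<close>, hence this quotient; \<open>norm f < 1\<close>
    makes the denominator positive.\<close>
  define s where "s l u = \<beta> l u / (1 - \<beta> l f)" for l u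
  define H where "H x = G x + defect x *\<^sub>R f" for x
  define P where "P l u = V.R l (u + s l u *\<^sub>R f)" for l u
  have \<beta>f: "\<beta> l f < 1" if "0 < l" for l using \<beta>_le_norm[OF that f(1)] f(2) by simp
  have \<beta>s: "\<beta> l (u + s l u *\<^sub>R f) = s l u" if l: "0 < l" for l u
  proof -
    have "\<beta> l u = s l u * (1 - \<beta> l f)" using \<beta>f[OF l] by (simp add: s_def)
    then show ?thesis
      by (simp add: linear_add[OF linear_\<beta>[OF l]] linear_scale[OF linear_\<beta>[OF l]] algebra_simps)
  qed
  have defect_P: "defect (P l u) = s l u" if l: "0 < l" for l u
    unfolding P_def by (simp add: defect_R[OF l] \<beta>s[OF l])
  have P_right: "l *\<^sub>R P l u - H (P l u) = u" if l: "0 < l" for l u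
    using V.R_right_inverse[OF l, of "u + s l u *\<^sub>R f"] unfolding H_def defect_P[OF l]
    by (simp add: P_def algebra_simps)
  interpret H: substochastic_resolvents DG H P
  proof
    have add: "defect (x + y) = defect x + defect y" if "x \<in> DG" "y \<in> DG" for x y
      using linear_add[OF linear_\<beta>[of 1], of "x - G x" "y - G y"] that
      by (simp add: defect_def V.A_add algebra_simps)
    have scale: "defect (c *\<^sub>R x) = c * defect x" if "x \<in> DG" for c x
      using linear_scale[OF linear_\<beta>[of 1], of c "x - G x"] that
      by (simp add: defect_def V.A_scaleR algebra_simps)
    show "linear_operator DG H"
      unfolding linear_operator_def H_def using V.subspace_D
      by (auto simp: V.A_add V.A_scaleR add scale algebra_simps)
    show "closure DG = UNIV" by (rule V.closure_D)
    fix l :: real and x assume l: "0 < l"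
    show "P l x \<in> DG" unfolding P_def by (rule V.R_in_D[OF l])
    show "l *\<^sub>R P l x - H (P l x) = x" by (rule P_right[OF l])
    show "P l (l *\<^sub>R y - H y) = y" if y: "y \<in> DG" for y
    proof -
      let ?w = "l *\<^sub>R y - G y"
      have eq: "l *\<^sub>R y - H y = ?w - defect y *\<^sub>R f" by (simp add: H_def)
      have "\<beta> l (l *\<^sub>R y - H y) = defect y * (1 - \<beta> l f)"
        unfolding eq linear_diff[OF linear_\<beta>[OF l], of ?w] linear_scale[OF linear_\<beta>[OF l], of _ f] defect_eq[OF l y]
        by (simp add: algebra_simps)
      then have "s l (l *\<^sub>R y - H y) = defect y" using \<beta>f[OF l] by (simp add: s_def)
      then have "P l (l *\<^sub>R y - H y) = V.R l ?w" by (simp add: P_def eq)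
      then show ?thesis using V.R_left_inverse[OF l y] by simp
    qed
    assume x: "0 \<le> x"
    have s0: "0 \<le> s l x" using \<beta>_nonneg[OF l x] \<beta>f[OF l] by (simp add: s_def)
    then have w: "0 \<le> x + s l x *\<^sub>R f" using x f by (intro add_nonneg_nonneg scaleR_nonneg_nonneg)
    then show P0: "0 \<le> P l x" unfolding P_def by (rule V.R_nonneg[OF l])
    \<comment> \<open>The mass balance: \<open>G\<close> loses at least \<open>s l x\<close>, while
      the feedback returns only \<open>s l x * norm f\<close>. So \<open>Psi\<close> of
      \<open>H (P l x)\<close> is at most 0, and the resolvent estimate follows.\<close>
    have "s l x \<le> - blinfun_apply Psi (G (P l x))"
      using \<beta>_le[OF l w] unfolding \<beta>s[OF l] P_def .
    moreover have "s l x * norm f \<le> s l x * 1" using s0 f by (intro mult_left_mono) auto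
    moreover have "blinfun_apply Psi (H (P l x)) = blinfun_apply Psi (G (P l x)) + s l x * norm f"
      unfolding H_def defect_P[OF l] by (simp add: blinfun.bilinear_simps Psi_nonneg f)
    ultimately have "blinfun_apply Psi (H (P l x)) \<le> 0" by linarith
    moreover have "blinfun_apply Psi (l *\<^sub>R P l x - H (P l x)) = norm x"
      unfolding P_right[OF l] by (rule Psi_nonneg[OF x])
    ultimately show "l * norm (P l x) \<le> norm x"
      using P0 by (simp add: blinfun.bilinear_simps Psi_nonneg)
  qed
  \<comment> \<open>The feedback is invisible on D(A), which is why the perturbed generator still
    extends \<open>A + B\<close>.\<close>
  have "defect x = 0" if "x \<in> DA" for x
    using \<beta>_vanishes[of 1 x] that by (simp add: defect_def)
  then have "operator_extension (generator_domain H.W) (generator H.W) DA (\<lambda>u. A u + B u)"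
    using H.W_operator_extension G_extension by (auto simp: operator_extension_def H_def)
  then have "H.W \<in> extending_semigroups DA A B"
    using H.W_substochastic_semigroup by (simp add: extending_semigroups_def)
  moreover have "\<forall>x\<in>DG. generator H.W x = G x + defect x *\<^sub>R f"
    using H.W_operator_extension by (simp add: operator_extension_def H_def)
  ultimately show ?thesis by blast
qed

lemma infinite_if_dishonest:
  assumes "\<not> honest DA A B V"
  shows "infinite (extending_semigroups DA A B)"
proof -
  obtain x where x: "x \<in> DG" "defect x \<noteq> 0" using assms honest_iff by blast
  \<comment> \<open>A nonzero positive vector exists because \<open>x\<close> is nonzero, having
    nonzero defect, and is a difference of positive vectors; normalizing gives
    \<open>f\<close>.\<close>
  have "\<exists>f::'a. 0 \<le> f \<and> norm f = 1"
  proof -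
    obtain u v :: 'a where uv: "0 \<le> u" "0 \<le> v" "x = u - v" using generating_nonneg_cone by blast
    have "x \<noteq> 0" using x V.A_scaleR[of x 0] linear_0[OF linear_\<beta>[of 1]] by (auto simp: defect_def)
    then obtain w :: 'a where "0 \<le> w" "w \<noteq> 0" using uv by (metis diff_self)
    then show ?thesis by (intro exI[of _ "w /\<^sub>R norm w"]) (auto intro: scaleR_nonneg_nonneg)
  qed
  then obtain f :: 'a where f: "0 \<le> f" "norm f = 1" by blast
  have "\<forall>c\<in>{0..<1::real}. \<exists>W\<in>extending_semigroups DA A B.
      \<forall>x\<in>DG. generator W x = G x + defect x *\<^sub>R (c *\<^sub>R f)"
    using f by (intro ballI feedback_semigroup) (auto intro: scaleR_nonneg_nonneg)
  then obtain W where W: "\<And>c::real. c \<in> {0..<1} \<Longrightarrow> W c \<in> extending_semigroups DA A B"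
    "\<And>c x. c \<in> {0..<1} \<Longrightarrow> x \<in> DG \<Longrightarrow> generator (W c) x = G x + defect x *\<^sub>R (c *\<^sub>R f)"
    by metis
  have "inj_on W {0..<1}"
  proof (rule inj_onI)
    fix c d assume cd: "c \<in> {0..<1}" "d \<in> {0..<1}" "W c = W d"
    have "G x + defect x *\<^sub>R (c *\<^sub>R f) = G x + defect x *\<^sub>R (d *\<^sub>R f)"
      using W(2)[OF cd(1) x(1)] W(2)[OF cd(2) x(1)] unfolding cd(3) by (rule trans[OF sym])
    moreover have "f \<noteq> 0" using f by auto
    ultimately show "c = d" using x(2) by simp
  qed
  then have "infinite (W ` {0..<1})" by (simp add: finite_image_iff)
  moreover have "W ` {0..<1} \<subseteq> extending_semigroups DA A B" using W(1) by blast
  ultimately show ?thesis by (metis finite_subset)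
qed

end

theorem theorem3p3:
  fixes A B :: "'a::abstract_state_space \<Rightarrow> 'a"
    and DA DB :: "'a set"
    and V :: "real \<Rightarrow> 'a \<Rightarrow>\<^sub>L 'a"
  assumes "kato_conditions DA A DB B"
    and "kato_semigroup DA A B V"
  shows "(honest DA A B V \<longrightarrow> extending_semigroups DA A B = {V}) \<and>
         (\<not> honest DA A B V \<longrightarrow> infinite (extending_semigroups DA A B))"
proof -
  obtain S where S: "substochastic_semigroup S" "generates DA A S"
    using assms(1) by (auto simp: kato_conditions_def)
  have V: "V \<in> extending_semigroups DA A B" using assms(2) by (simp add: kato_semigroup_def)
  have DB: "x \<in> DA \<Longrightarrow> x \<in> DB" for x using assms(1) by (auto simp: kato_conditions_def)
  interpret kato_perturbation DA A S V B
  proof (intro kato_perturbation.intro kato_perturbation_axioms.intro)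
    show "substochastic_generation DA A S" using S by (rule substochastic_generation.intro)
    show "substochastic_generation (generator_domain V) (generator V) V"
      using V by (intro substochastic_generationI) (simp add: extending_semigroups_def)
  qed (use assms V DB in \<open>auto simp: kato_conditions_def kato_semigroup_def linear_operator_def\<close>)
  show ?thesis using unique_if_honest infinite_if_dishonest V by blast
qed

end
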